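(* Let $m\ge 0$ be an integer and let $M\subset H^2$ be a closed subspace. Then $M$ is almost-invariant for $S^*$ with defect $m$ if and only if there is an $m$-dimensional subspace $F$ of $H^2$, orthogonal to $M$, with an orthonormal basis $\{e_1,\ldots,e_m\}$, such that one of the following holds: (i) there are functions in $M$ that do not vanish at $0$, and $$M=\Big\{f:\ f(z)=k_0(z)f_0(z)+z\sum_{j=1}^m k_j(z)e_j(z):\ (k_0,\ldots,k_m)\in K\Big\},$$ where $f_0$ is the normalized reproducing kernel for $M$ at $0$, $K$ is a closed subspace of $H^2(\mathbb{D};\mathbb{C}^{m+1})$ invariant under $S^*\oplus\cdots\oplus S^*$, $\|f\|^2=\sum_{j=0}^m\|k_j\|^2$ for every $f$ represented in this way by $(k_0,\ldots,k_m)\in K$, and in addition $S^*f_0\in M\oplus F$; (ii) all functions in $M$ vanish at $0$, and $$M=\Big\{f:\ f(z)=z\sum_{j=1}^m k_j(z)e_j(z):\ (k_1,\ldots,k_m)\in K\Big\},$$ where $K$ is a closed subspace of $H^2(\mathbb{D};\mathbb{C}^{m})$ invariant under $S^*\oplus\cdots\oplus S^*$, and $\|f\|^2=\sum_{j=1}^m\|k_j\|^2$ for every $f$ represented in this way by $(k_1,\ldots,k_m)\in K$.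
   Context: $H^2$ is the Hardy space of the open unit disc $\mathbb{D}$, and $S^*f(z)=(f(z)-f(0))/z$ is the backward shift on $H^2$, the adjoint of $Sf(z)=zf(z)$. A closed subspace $M\subset H^2$ is almost-invariant for $S^*$ with defect $m$ if $S^*M\subset M\oplus F$ for some subspace $F$ of $H^2$ with $\dim F=m$ (which may be taken to be orthogonal to $M$). (Here $m$ is not required to be minimal.) If some function of $M$ does not vanish at $0$, the normalized reproducing kernel for $M$ at $0$ is $f_0=\kappa_0/\|\kappa_0\|$, where $\kappa_0\in M$ is the element with $\langle f,\kappa_0\rangle=f(0)$ for all $f\in M$. $H^2(\mathbb{D};\mathbb{C}^n)$ is identified with the direct sum of $n$ copies of $H^2$, with $\|(k_1,\dots,k_n)\|^2=\sum_j\|k_j\|^2$, and $S^*\oplus\cdots\oplus S^*$ acts coordinatewise. Empty sums are zero. *)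

theory Defs
  imports "HOL-Complex_Analysis.Complex_Analysis" "HOL-Library.Function_Algebras"
begin

section \<open>The Hardy space of the unit disc\<close>

definition taylor :: "(complex \<Rightarrow> complex) \<Rightarrow> nat \<Rightarrow> complex" where
  "taylor f n = fps_nth (fps_expansion f 0) n"

text \<open>
  Elements are holomorphic functions on the disc with square-summable Taylor coefficients.
  HOL functions are total, so a function on the disc is represented by its extension by \<open>0\<close>;
  equality of representatives is then equality on the disc.
\<close>

typedef hardy =
  "{f :: complex \<Rightarrow> complex. f holomorphic_on ball 0 1 \<and> (\<forall>z. z \<notin> ball 0 1 \<longrightarrow> f z = 0) \<and>
      summable (\<lambda>n. (cmod (taylor f n))\<^sup>2)}"
  morphisms hfun Abs_hardy
proof
  have "fps_expansion (\<lambda>z. 0 :: complex) 0 = 0"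
    by (rule fps_expansion_eqI) simp
  then show "(\<lambda>_. 0) \<in> {f :: complex \<Rightarrow> complex. f holomorphic_on ball 0 1 \<and>
      (\<forall>z. z \<notin> ball 0 1 \<longrightarrow> f z = 0) \<and> summable (\<lambda>n. (cmod (taylor f n))\<^sup>2)}"
    by (simp add: taylor_def)
qed

setup_lifting type_definition_hardy

definition hcoeff :: "hardy \<Rightarrow> nat \<Rightarrow> complex" where
  "hcoeff f n = taylor (hfun f) n"

lemma hfun_holomorphic: "hfun f holomorphic_on ball 0 1"
  and hfun_outside: "z \<notin> ball 0 1 \<Longrightarrow> hfun f z = 0"
  and hcoeff_summable: "summable (\<lambda>n. (cmod (hcoeff f n))\<^sup>2)"
  using hfun[of f] by (auto simp: hcoeff_def)

lemma hol_has_fps_expansion: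
  assumes "f holomorphic_on ball 0 1"
  shows "f has_fps_expansion fps_expansion f 0"
  using assms by (intro has_fps_expansion_fps_expansion[of "ball 0 1"]) auto

lemma taylor_add:
  assumes "f holomorphic_on ball 0 1" "g holomorphic_on ball 0 1"
  shows "taylor (\<lambda>z. f z + g z) n = taylor f n + taylor g n"
proof -
  have "fps_expansion (\<lambda>z. f z + g z) 0 = fps_expansion f 0 + fps_expansion g 0"
    by (intro fps_expansion_eqI has_fps_expansion_add hol_has_fps_expansion assms)
  then show ?thesis by (simp add: taylor_def)
qed

lemma taylor_cmult:
  assumes "f holomorphic_on ball 0 1"
  shows "taylor (\<lambda>z. c * f z) n = c * taylor f n"
proof -
  have "fps_expansion (\<lambda>z. c * f z) 0 = fps_const c * fps_expansion f 0"
    by (intro fps_expansion_eqI has_fps_expansion_cmult_left hol_has_fps_expansion assms)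
  then show ?thesis by (simp add: taylor_def)
qed

lemma norm_add_sq_le: "(cmod (a + b))\<^sup>2 \<le> 2 * (cmod a)\<^sup>2 + 2 * (cmod b)\<^sup>2"
proof -
  have "(cmod (a + b))\<^sup>2 \<le> (cmod a + cmod b)\<^sup>2"
    by (intro power_mono norm_triangle_ineq) auto
  also have "\<dots> \<le> 2 * (cmod a)\<^sup>2 + 2 * (cmod b)\<^sup>2"
    using sum_squares_ge_zero[of "cmod a - cmod b" 0]
    by (simp add: power2_eq_square algebra_simps)
  finally show ?thesis .
qed

lemma summable_norm_sq_add:
  assumes "summable (\<lambda>n. (cmod (a n))\<^sup>2)" "summable (\<lambda>n. (cmod (b n))\<^sup>2)"
  shows "summable (\<lambda>n. (cmod (a n + b n))\<^sup>2)"
proof (rule summable_comparison_test)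
  show "summable (\<lambda>n. 2 * (cmod (a n))\<^sup>2 + 2 * (cmod (b n))\<^sup>2)"
    by (intro summable_add summable_mult assms)
  show "\<exists>N. \<forall>n\<ge>N. norm ((cmod (a n + b n))\<^sup>2) \<le> 2 * (cmod (a n))\<^sup>2 + 2 * (cmod (b n))\<^sup>2"
    using norm_add_sq_le by auto
qed

lemma summable_norm_sq_cmult:
  assumes "summable (\<lambda>n. (cmod (a n))\<^sup>2)"
  shows "summable (\<lambda>n. (cmod (c * a n))\<^sup>2)"
  using summable_mult[OF assms, of "(cmod c)\<^sup>2"] by (simp add: norm_mult power_mult_distrib)

lift_definition scaleC :: "complex \<Rightarrow> hardy \<Rightarrow> hardy"  (infixr "*\<^sub>C" 75) is "\<lambda>c f z. c * f z"
  by (auto intro!: holomorphic_intros simp: taylor_cmult summable_norm_sq_cmult)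

instantiation hardy :: real_vector
begin

lift_definition zero_hardy :: hardy is "\<lambda>z. 0"
proof -
  have "fps_expansion (\<lambda>z. 0 :: complex) 0 = 0"
    by (rule fps_expansion_eqI) simp
  then show "(\<lambda>z. 0 :: complex) holomorphic_on ball 0 1 \<and> (\<forall>z :: complex. z \<notin> ball 0 1 \<longrightarrow> (0 :: complex) = 0) \<and>
      summable (\<lambda>n. (cmod (taylor (\<lambda>z. 0) n))\<^sup>2)"
    by (simp add: taylor_def)
qed

lift_definition plus_hardy :: "hardy \<Rightarrow> hardy \<Rightarrow> hardy" is "\<lambda>f g z. f z + g z"
  by (auto intro!: holomorphic_intros simp: taylor_add summable_norm_sq_add)

definition uminus_hardy :: "hardy \<Rightarrow> hardy" where "- f = (-1) *\<^sub>C f"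
definition minus_hardy :: "hardy \<Rightarrow> hardy \<Rightarrow> hardy" where "f - g = f + (-1) *\<^sub>C g"
definition scaleR_hardy :: "real \<Rightarrow> hardy \<Rightarrow> hardy" where "r *\<^sub>R f = of_real r *\<^sub>C f"

instance
proof
qed (unfold uminus_hardy_def minus_hardy_def scaleR_hardy_def, (transfer, simp add: algebra_simps fun_eq_iff)+)

end

lemma hfun_zero [simp]: "hfun 0 z = 0"
  and hfun_add [simp]: "hfun (f + g) z = hfun f z + hfun g z"
  and hfun_scaleC [simp]: "hfun (c *\<^sub>C f) z = c * hfun f z"
  by (transfer, simp)+

lemma hfun_uminus [simp]: "hfun (- f) z = - hfun f z"
  and hfun_diff [simp]: "hfun (f - g) z = hfun f z - hfun g z"
  and hfun_scaleR [simp]: "hfun (r *\<^sub>R f) z = of_real r * hfun f z"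
  by (simp_all add: uminus_hardy_def minus_hardy_def scaleR_hardy_def)

lemma hardy_eqI: "(\<And>z. z \<in> ball 0 1 \<Longrightarrow> hfun f z = hfun g z) \<Longrightarrow> f = g"
  by (metis hfun_inject hfun_outside ext)

lemma hcoeff_add: "hcoeff (f + g) n = hcoeff f n + hcoeff g n"
  unfolding hcoeff_def by transfer (simp add: taylor_add)

lemma hcoeff_scaleC: "hcoeff (c *\<^sub>C f) n = c * hcoeff f n"
  unfolding hcoeff_def by transfer (simp add: taylor_cmult)

lemma hfun_sums:
  assumes "z \<in> ball 0 1"
  shows "(\<lambda>n. hcoeff f n * z ^ n) sums hfun f z"
  using holomorphic_power_series[OF hfun_holomorphic assms, of f]
  by (simp add: hcoeff_def taylor_def fps_expansion_def)

definition cinner :: "hardy \<Rightarrow> hardy \<Rightarrow> complex" where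
  "cinner f g = (\<Sum>n. hcoeff f n * cnj (hcoeff g n))"

lemma cinner_summable: "summable (\<lambda>n. hcoeff f n * cnj (hcoeff g n))"
proof (rule summable_comparison_test)
  show "summable (\<lambda>n. (cmod (hcoeff f n))\<^sup>2 + (cmod (hcoeff g n))\<^sup>2)"
    by (intro summable_add hcoeff_summable)
  have "a * b \<le> a\<^sup>2 + b\<^sup>2" for a b :: real
  proof -
    have "0 \<le> a\<^sup>2" "0 \<le> b\<^sup>2" by simp_all
    moreover have "2 * (a * b) \<le> a\<^sup>2 + b\<^sup>2"
      using sum_squares_bound[of a b] by (simp add: mult.assoc)
    ultimately show ?thesis by linarith
  qed
  then show "\<exists>N. \<forall>n\<ge>N. norm (hcoeff f n * cnj (hcoeff g n)) \<le> (cmod (hcoeff f n))\<^sup>2 + (cmod (hcoeff g n))\<^sup>2"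
    by (auto simp: norm_mult)
qed

lemma cinner_add_left: "cinner (f + g) h = cinner f h + cinner g h"
  unfolding cinner_def
  by (simp add: hcoeff_add distrib_right suminf_add cinner_summable)

lemma cinner_scaleC_left: "cinner (c *\<^sub>C f) g = c * cinner f g"
  unfolding cinner_def
  by (simp add: hcoeff_scaleC mult.assoc suminf_mult cinner_summable)

lemma cinner_commute: "cinner f g = cnj (cinner g f)"
proof -
  have "(\<lambda>n. cnj (hcoeff g n * cnj (hcoeff f n))) sums cnj (cinner g f)"
    unfolding cinner_def by (intro sums_cnj[THEN iffD2] summable_sums cinner_summable)
  then have "(\<lambda>n. hcoeff f n * cnj (hcoeff g n)) sums cnj (cinner g f)"
    by (simp add: mult.commute)
  then show ?thesis
    unfolding cinner_def[of f g] by (rule sums_unique[symmetric])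
qed

lemma cinner_self: "cinner f f = of_real (\<Sum>n. (cmod (hcoeff f n))\<^sup>2)"
  unfolding cinner_def complex_norm_square[symmetric]
  by (rule suminf_of_real[OF hcoeff_summable, symmetric])

instantiation hardy :: real_inner
begin

definition inner_hardy :: "hardy \<Rightarrow> hardy \<Rightarrow> real" where
  "inner_hardy f g = Re (cinner f g)"

definition norm_hardy :: "hardy \<Rightarrow> real" where
  "norm_hardy f = sqrt (\<Sum>n. (cmod (hcoeff f n))\<^sup>2)"

definition dist_hardy :: "hardy \<Rightarrow> hardy \<Rightarrow> real" where
  "dist_hardy f g = norm (f - g)"

definition sgn_hardy :: "hardy \<Rightarrow> hardy" where
  "sgn_hardy f = f /\<^sub>R norm f"

definition uniformity_hardy :: "(hardy \<times> hardy) filter" where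
  "uniformity_hardy = (INF e\<in>{0<..}. principal {(f, g). dist f g < e})"

definition open_hardy :: "hardy set \<Rightarrow> bool" where
  "open_hardy U = (\<forall>f\<in>U. eventually (\<lambda>(f', g). f' = f \<longrightarrow> g \<in> U) uniformity)"

instance
proof
  fix f g h :: hardy and r :: real
  show "inner f g = inner g f"
    unfolding inner_hardy_def using cinner_commute[of f g] by simp
  show "inner (f + g) h = inner f h + inner g h"
    by (simp add: inner_hardy_def cinner_add_left)
  show "inner (r *\<^sub>R f) g = r * inner f g"
    by (simp add: inner_hardy_def scaleR_hardy_def cinner_scaleC_left)
  show "0 \<le> inner f f"
    by (simp add: inner_hardy_def cinner_self suminf_nonneg hcoeff_summable)
  show "inner f f = 0 \<longleftrightarrow> f = 0"
  proof
    assume "inner f f = 0"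
    then have "(\<Sum>n. (cmod (hcoeff f n))\<^sup>2) = 0"
      by (simp add: inner_hardy_def cinner_self)
    then have "hcoeff f n = 0" for n
      using suminf_eq_zero_iff[OF hcoeff_summable[of f]] by simp
    then have "hfun f z = 0" if "z \<in> ball 0 1" for z
      using hfun_sums[OF that, of f] by (simp add: sums_iff)
    then show "f = 0"
      by (intro hardy_eqI) simp
  next
    assume "f = 0"
    moreover have "cinner 0 0 = 0"
      using cinner_scaleC_left[of 0 0 0] by (metis hardy_eqI hfun_scaleC hfun_zero mult_zero_left)
    ultimately show "inner f f = 0"
      by (simp add: inner_hardy_def)
  qed
  show "norm f = sqrt (inner f f)"
    by (simp add: norm_hardy_def inner_hardy_def cinner_self)
qed (simp_all add: dist_hardy_def sgn_hardy_def uniformity_hardy_def open_hardy_def)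

end

interpretation hardy: vector_space scaleC
  by unfold_locales (transfer, simp add: algebra_simps fun_eq_iff)+

text \<open>
  \<open>hardy.dim F = m\<close> would not do: for \<open>m = 0\<close> it also holds of infinite-dimensional \<open>F\<close>.
\<close>

definition has_cdim :: "hardy set \<Rightarrow> nat \<Rightarrow> bool" where
  "has_cdim F m \<longleftrightarrow> (\<exists>B. finite B \<and> card B = m \<and> \<not> hardy.dependent B \<and> hardy.span B = F)"

definition orthogonal_sets :: "hardy set \<Rightarrow> hardy set \<Rightarrow> bool" where
  "orthogonal_sets A B \<longleftrightarrow> (\<forall>f\<in>A. \<forall>g\<in>B. cinner f g = 0)"

definition orthonormal_basis :: "(nat \<Rightarrow> hardy) \<Rightarrow> nat \<Rightarrow> hardy set \<Rightarrow> bool" where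
  "orthonormal_basis e m F \<longleftrightarrow>
     (\<forall>i\<in>{1..m}. \<forall>j\<in>{1..m}. cinner (e i) (e j) = (if i = j then 1 else 0)) \<and>
     hardy.span (e ` {1..m}) = F"


section \<open>The backward shift and almost-invariant subspaces\<close>

lemma bshift_aux:
  assumes f: "f holomorphic_on ball 0 1"
  defines "g \<equiv> (\<lambda>z :: complex. if z \<in> ball 0 1 then if z = 0 then deriv f 0 else (f z - f 0) / z else 0)"
  shows "g holomorphic_on ball 0 1" "taylor g n = taylor f (Suc n)"
proof -
  have "(\<lambda>z. if z = 0 then deriv f 0 else (f z - f 0) / (z - 0)) holomorphic_on ball 0 1"
    by (rule pole_lemma_open[OF f]) simp
  then show hol: "g holomorphic_on ball 0 1"
    by (rule holomorphic_transform) (auto simp: g_def)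
  have "f 0 + z * g z = f z" if "z \<in> ball 0 1" for z
    using that by (auto simp: g_def)
  moreover have "eventually (\<lambda>z :: complex. z \<in> ball 0 1) (nhds 0)"
    by (intro eventually_nhds_in_open) auto
  ultimately have ev: "eventually (\<lambda>z. f 0 + z * g z = f z) (nhds 0)"
    by (rule eventually_mono[rotated])
  have "(\<lambda>z. f 0 + z * g z) has_fps_expansion fps_const (f 0) + fps_X * fps_expansion g 0"
    by (intro fps_expansion_intros hol_has_fps_expansion hol)
  then have "f has_fps_expansion fps_const (f 0) + fps_X * fps_expansion g 0"
    using has_fps_expansion_cong[OF ev refl] by blast
  then have "fps_expansion f 0 = fps_const (f 0) + fps_X * fps_expansion g 0"
    by (rule fps_expansion_eqI)
  then show "taylor g n = taylor f (Suc n)"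
    by (simp add: taylor_def)
qed

text \<open>The value at \<open>0\<close> fills the removable singularity of \<open>(f z - f 0) / z\<close>.\<close>

lift_definition bshift :: "hardy \<Rightarrow> hardy" is
  "\<lambda>f z. if z \<in> ball 0 1 then if z = 0 then deriv f 0 else (f z - f 0) / z else 0"
  subgoal premises prems for f
    using prems bshift_aux[of f] summable_Suc_iff[of "\<lambda>n. (cmod (taylor f n))\<^sup>2"] by simp
  done

text \<open>
  The sum \<open>M + F\<close> is required to be direct, but not orthogonal; \<open>m\<close> need not be minimal.
\<close>

definition almost_invariant_bshift :: "hardy set \<Rightarrow> nat \<Rightarrow> bool" where
  "almost_invariant_bshift M m \<longleftrightarrow>
     hardy.subspace M \<and> closed M \<and>
     (\<exists>F. hardy.subspace F \<and> has_cdim F m \<and> M \<inter> F = {0} \<and> bshift ` M \<subseteq> M + F)"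

text \<open>By the Riesz representation theorem, the description is proper when \<open>M\<close> is a closed subspace.\<close>

definition kernel0 :: "hardy set \<Rightarrow> hardy" where
  "kernel0 M = (THE \<kappa>. \<kappa> \<in> M \<and> (\<forall>f\<in>M. cinner f \<kappa> = hfun f 0))"

definition normalized_kernel0 :: "hardy set \<Rightarrow> hardy" where
  "normalized_kernel0 M = kernel0 M /\<^sub>R norm (kernel0 M)"


section \<open>Vector-valued Hardy spaces\<close>

text \<open>
  \<open>hardy_tuples I\<close> is the direct sum of copies of the Hardy space indexed by the finite set \<open>I\<close>;
  families are extended by \<open>0\<close> to all indices. The Hardy space with values in \<open>\<complex>\<^sup>m\<^sup>+\<^sup>1\<close> is obtained
  for \<open>I = {0..m}\<close>, the one with values in \<open>\<complex>\<^sup>m\<close> for \<open>I = {1..m}\<close>.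
\<close>

definition hardy_tuples :: "nat set \<Rightarrow> (nat \<Rightarrow> hardy) set" where
  "hardy_tuples I = {k. \<forall>j. j \<notin> I \<longrightarrow> k j = 0}"

definition tuple_dist :: "nat set \<Rightarrow> (nat \<Rightarrow> hardy) \<Rightarrow> (nat \<Rightarrow> hardy) \<Rightarrow> real" where
  "tuple_dist I k l = L2_set (\<lambda>j. norm (k j - l j)) I"

lemma Metric_space_hardy_tuples:
  assumes "finite I"
  shows "Metric_space (hardy_tuples I) (tuple_dist I)"
proof
  fix k l h :: "nat \<Rightarrow> hardy"
  show "0 \<le> tuple_dist I k l"
    by (simp add: tuple_dist_def)
  show "tuple_dist I k l = tuple_dist I l k"
    by (simp add: tuple_dist_def norm_minus_commute)
  show "tuple_dist I k l = 0 \<longleftrightarrow> k = l" if "k \<in> hardy_tuples I" "l \<in> hardy_tuples I"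
    using that assms by (auto simp: tuple_dist_def L2_set_eq_0_iff hardy_tuples_def fun_eq_iff)
  have "tuple_dist I k h \<le> L2_set (\<lambda>j. norm (k j - l j) + norm (l j - h j)) I"
    unfolding tuple_dist_def by (rule L2_set_mono) (auto intro: norm_diff_triangle_le)
  also have "\<dots> \<le> tuple_dist I k l + tuple_dist I l h"
    unfolding tuple_dist_def by (rule L2_set_triangle_ineq)
  finally show "tuple_dist I k h \<le> tuple_dist I k l + tuple_dist I l h" .
qed

definition tuple_topology :: "nat set \<Rightarrow> (nat \<Rightarrow> hardy) topology" where
  "tuple_topology I = Metric_space.mtopology (hardy_tuples I) (tuple_dist I)"

interpretation tuple: vector_space "\<lambda>c (k :: nat \<Rightarrow> hardy) j. c *\<^sub>C k j"
  by unfold_locales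
    (auto simp: fun_eq_iff plus_fun_def hardy.scale_right_distrib hardy.scale_left_distrib)

definition closed_bshift_invariant :: "nat set \<Rightarrow> (nat \<Rightarrow> hardy) set \<Rightarrow> bool" where
  "closed_bshift_invariant I K \<longleftrightarrow>
     K \<subseteq> hardy_tuples I \<and> tuple.subspace K \<and> closedin (tuple_topology I) K \<and>
     (\<forall>k\<in>K. (\<lambda>j. bshift (k j)) \<in> K)"

end

theory Submission
  imports Defs
begin

text \<open>
  Write \<open>P\<close> for the orthogonal projection onto \<open>M\<close>, \<open>S\<close> for the shift, \<open>R f = f - \<langle>f, f0\<rangle> f0\<close> and
  \<open>C = P S\<^sup>* R\<close>. Every \<open>f\<close> in \<open>M\<close> splits as \<open>f = \<langle>f, f0\<rangle> f0 + z (C f + \<Sum>\<^sub>j c\<^sub>j e\<^sub>j)\<close>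
  with \<open>\<parallel>f\<parallel>\<^sup>2 = \<parallel>C f\<parallel>\<^sup>2 + \<bar>\<langle>f, f0\<rangle>\<bar>\<^sup>2 + \<Sum>\<^sub>j \<bar>c\<^sub>j\<bar>\<^sup>2\<close>, and iterating this along \<open>C\<^sup>n f\<close> yields the
  coefficients of the functions \<open>k\<^sub>j\<close>. The representation holds pointwise because \<open>z\<^sup>n C\<^sup>n f\<close> tends to
  \<open>0\<close> there; the isometry requires \<open>C\<^sup>n f \<rightarrow> 0\<close> in norm.

  If the functionals are \<open>\<langle>\<cdot>, v\<^sub>j\<rangle>\<close>, the vectors \<open>h = C\<^sup>*\<^sup>p v\<^sub>q\<close> span a dense subspace of \<open>M\<close>, since a
  vector orthogonal to all of them has all \<open>k\<^sub>j = 0\<close>. For such \<open>h\<close> the energy identity, summed over the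
  partial sums \<open>\<Sum>\<^sub>i\<^sub><\<^sub>n S\<^sup>i \<otimes> C\<^sup>i\<close>, telescopes and shows that multiplication by the partial sums of
  \<open>k\<^sub>j\<close> is bounded on the Hardy space in quadratic mean over \<open>n\<close>. As \<open>S\<^sup>*\<^sup>n \<rightarrow> 0\<close> strongly, this forces
  \<open>C\<^sup>n h \<rightarrow> 0\<close>.
\<close>

section \<open>Hilbert space structure\<close>

lemma hcoeff_zero [simp]: "hcoeff 0 n = 0"
  using hcoeff_scaleC[of 0 0 n] by (simp add: hardy.scale_zero_left)

lemma hcoeff_diff: "hcoeff (f - g) n = hcoeff f n - hcoeff g n"
  unfolding minus_hardy_def hcoeff_add hcoeff_scaleC by simp

lemma hcoeff_sum: "hcoeff (\<Sum>i\<in>A. f i) n = (\<Sum>i\<in>A. hcoeff (f i) n)"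
  by (induction A rule: infinite_finite_induct) (auto simp: hcoeff_add)

lemma hfun_sum: "hfun (\<Sum>i\<in>A. f i) z = (\<Sum>i\<in>A. hfun (f i) z)"
  by (induction A rule: infinite_finite_induct) auto

lemma hardy_eq_coeffI:
  assumes "\<And>n. hcoeff f n = hcoeff g n"
  shows "f = g"
proof (rule hardy_eqI)
  fix z :: complex assume "z \<in> ball 0 1"
  from hfun_sums[OF this, of f] hfun_sums[OF this, of g] show "hfun f z = hfun g z"
    by (simp add: assms sums_unique2)
qed

lemma hfun_0: "hfun f 0 = hcoeff f 0"
  by (simp add: hcoeff_def taylor_def fps_expansion_def)

text \<open>Inverse of \<open>hcoeff\<close> on square-summable sequences, the ones for which it is
  meant.\<close>

definition hardy_of :: "(nat \<Rightarrow> complex) \<Rightarrow> hardy" where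
  "hardy_of a = Abs_hardy (\<lambda>z. if z \<in> ball 0 1 then (\<Sum>n. a n * z ^ n) else 0)"

text \<open>For 0 < r < 1 the terms |a_n| r^n are dominated by |a_n|^2 + r^(2n), so the power series
  has radius of convergence at least 1. Its coefficients are then recovered from uniqueness of the
  expansion at 0.\<close>

lemma hcoeff_hardy_of:
  assumes a: "summable (\<lambda>n. (cmod (a n))\<^sup>2)"
  shows "hcoeff (hardy_of a) n = a n"
proof -
  define g where "g = (\<lambda>z. if z \<in> ball 0 1 then (\<Sum>n. a n * z ^ n) else 0)"
  define A where "A = Abs_fps a"
  have "summable (\<lambda>n. a n * of_real r ^ n)" if r: "0 < r" "r < 1" for r :: real
  proof (rule summable_comparison_test)
    have "summable (\<lambda>n. (r\<^sup>2) ^ n)"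
      using r by (intro summable_geometric) (auto simp: power_less_one_iff abs_square_less_1)
    with a show "summable (\<lambda>n. (cmod (a n))\<^sup>2 + (r\<^sup>2) ^ n)"
      by (rule summable_add)
    have "cmod (a n) * r ^ n \<le> (cmod (a n))\<^sup>2 + (r\<^sup>2) ^ n" for n
    proof -
      have "2 * (cmod (a n) * r ^ n) \<le> (cmod (a n))\<^sup>2 + (r ^ n)\<^sup>2"
        using sum_squares_bound[of "cmod (a n)" "r ^ n"] by simp
      moreover have "0 \<le> cmod (a n) * r ^ n" using r by simp
      ultimately show ?thesis
        by (simp add: power_mult[symmetric] mult.commute)
    qed
    then show "\<exists>N. \<forall>n\<ge>N. norm (a n * of_real r ^ n) \<le> (cmod (a n))\<^sup>2 + (r\<^sup>2) ^ n"
      using r by (auto simp: norm_mult norm_power)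
  qed
  then have rad: "fps_conv_radius A \<ge> 1"
    unfolding fps_conv_radius_def A_def
    by (intro conv_radius_geI_ex') (auto simp: one_ereal_def)
  have g_eval: "g z = eval_fps A z" if "z \<in> ball 0 1" for z
    using that by (simp add: g_def eval_fps_def A_def)
  have "eval_fps A holomorphic_on ball 0 1"
    using rad by (intro holomorphic_intros)
      (auto simp: ball_def eball_def one_ereal_def intro!: less_le_trans[OF _ rad[unfolded one_ereal_def]])
  then have hol: "g holomorphic_on ball 0 1"
    by (rule holomorphic_transform) (simp add: g_eval)
  have "eventually (\<lambda>z :: complex. z \<in> ball 0 1) (nhds 0)"
    by (intro eventually_nhds_in_open) auto
  then have "eventually (\<lambda>z. eval_fps A z = g z) (nhds 0)"
    by eventually_elim (simp add: g_eval)
  then have "g has_fps_expansion A"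
    unfolding has_fps_expansion_def using less_le_trans[OF _ rad, of 0] by simp
  then have ty: "taylor g n = a n" for n
    by (simp add: taylor_def fps_expansion_eqI A_def)
  have "hfun (hardy_of a) = g"
    unfolding hardy_of_def g_def[symmetric]
    by (rule Abs_hardy_inverse) (auto simp: hol ty a, simp_all add: g_def)
  then show ?thesis
    by (simp add: hcoeff_def ty)
qed

section \<open>Sesquilinearity, norm and coefficient bounds\<close>

lemma cinner_add_right: "cinner f (g + h) = cinner f g + cinner f h"
  by (simp add: cinner_commute[of f] cinner_add_left)

lemma cinner_scaleC_right: "cinner f (c *\<^sub>C g) = cnj c * cinner f g"
  by (simp add: cinner_commute[of f] cinner_scaleC_left)

lemma cinner_diff_left: "cinner (f - g) h = cinner f h - cinner g h"
  unfolding minus_hardy_def cinner_add_left cinner_scaleC_left by simp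

lemma cinner_diff_right: "cinner f (g - h) = cinner f g - cinner f h"
  unfolding minus_hardy_def cinner_add_right cinner_scaleC_right by simp

lemma cinner_zero_left [simp]: "cinner 0 f = 0"
  using cinner_diff_left[of f f f] by simp

lemma cinner_zero_right [simp]: "cinner f 0 = 0"
  using cinner_diff_right[of f f f] by simp

lemma cinner_sum_left: "cinner (\<Sum>i\<in>A. f i) g = (\<Sum>i\<in>A. cinner (f i) g)"
  by (induction A rule: infinite_finite_induct) (auto simp: cinner_add_left)

lemma cinner_sum_right: "cinner g (\<Sum>i\<in>A. f i) = (\<Sum>i\<in>A. cinner g (f i))"
  by (induction A rule: infinite_finite_induct) (auto simp: cinner_add_right)

lemma norm_hardy_sq: "(norm f)\<^sup>2 = (\<Sum>n. (cmod (hcoeff f n))\<^sup>2)"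
  by (simp add: norm_hardy_def suminf_nonneg hcoeff_summable)

lemma cinner_self_norm: "cinner f f = of_real ((norm f)\<^sup>2)"
  by (simp only: cinner_self norm_hardy_sq)

lemma cinner_eq_0_commute: "cinner f g = 0 \<longleftrightarrow> cinner g f = 0"
  using cinner_commute[of f g] by simp

lemma norm_scaleC: "norm (c *\<^sub>C f) = cmod c * norm f"
proof (rule power2_eq_imp_eq)
  show "(norm (c *\<^sub>C f))\<^sup>2 = (cmod c * norm f)\<^sup>2"
    unfolding norm_hardy_sq power_mult_distrib
    by (simp add: hcoeff_scaleC norm_mult power_mult_distrib suminf_mult hcoeff_summable)
qed auto

lemma norm_add_sq_hardy: "(norm (f + g))\<^sup>2 = (norm f)\<^sup>2 + (norm g)\<^sup>2 + 2 * Re (cinner f g)"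
  by (simp add: power2_norm_eq_inner inner_hardy_def cinner_add_left cinner_add_right
      cinner_commute[of g f])

lemma norm_diff_sq_hardy: "(norm (f - g))\<^sup>2 = (norm f)\<^sup>2 + (norm g)\<^sup>2 - 2 * Re (cinner f g)"
  by (simp add: power2_norm_eq_inner inner_hardy_def cinner_diff_left cinner_diff_right
      cinner_commute[of g f])

lemma pythagoras_hardy: "cinner f g = 0 \<Longrightarrow> (norm (f + g))\<^sup>2 = (norm f)\<^sup>2 + (norm g)\<^sup>2"
  by (simp add: norm_add_sq_hardy)

text \<open>A unimodular factor \<open>u\<close> rotates \<open>f\<close> so that the inner product
  becomes real and nonnegative; there the inequality of the underlying real inner product space
  applies.\<close>

lemma cinner_Cauchy_Schwarz: "cmod (cinner f g) \<le> norm f * norm g"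
proof (cases "cinner f g = 0")
  case False
  define u where "u = cnj (sgn (cinner f g))"
  have "cmod (cinner f g) = Re (u * cinner f g)"
  proof -
    have "u * cinner f g = (cinner f g * cnj (cinner f g)) / of_real (cmod (cinner f g))"
      by (simp add: u_def sgn_eq)
    also have "\<dots> = of_real (cmod (cinner f g))"
      using False by (simp only: complex_norm_square[symmetric]) (simp add: power2_eq_square)
    finally show ?thesis by simp
  qed
  also have "\<dots> = inner (u *\<^sub>C f) g"
    by (simp add: inner_hardy_def cinner_scaleC_left)
  also have "\<dots> \<le> norm (u *\<^sub>C f) * norm g"
    by (rule norm_cauchy_schwarz)
  also have "\<dots> = norm f * norm g"
    using False by (simp add: norm_scaleC u_def norm_sgn)
  finally show ?thesis .
qed auto

lemma sum_hcoeff_le_norm: "(\<Sum>n<L. (cmod (hcoeff f n))\<^sup>2) \<le> (norm f)\<^sup>2"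
  unfolding norm_hardy_sq by (intro sum_le_suminf hcoeff_summable) auto

lemma hcoeff_le_norm: "cmod (hcoeff f n) \<le> norm f"
proof -
  have "(cmod (hcoeff f n))\<^sup>2 \<le> (\<Sum>i<Suc n. (cmod (hcoeff f i))\<^sup>2)"
    by (rule member_le_sum) auto
  also have "\<dots> \<le> (norm f)\<^sup>2" by (rule sum_hcoeff_le_norm)
  finally show ?thesis by (simp add: power2_le_iff_abs_le)
qed

lemma norm_sq_le_hcoeff:
  assumes "\<And>L. (\<Sum>n<L. (cmod (hcoeff f n))\<^sup>2) \<le> B"
  shows "(norm f)\<^sup>2 \<le> B"
  unfolding norm_hardy_sq by (intro suminf_le_const hcoeff_summable assms)

text \<open>Cauchy sequences converge coefficientwise. The Cauchy estimate on the first
  \<open>L\<close> coefficients survives the limit with a bound independent of \<open>L\<close>,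
  which gives both square-summability of the limit and convergence in norm.\<close>

instance hardy :: banach
proof
  fix X :: "nat \<Rightarrow> hardy"
  assume X: "Cauchy X"
  have "Cauchy (\<lambda>i. hcoeff (X i) n)" for n
  proof (rule metric_CauchyI)
    fix e :: real assume "e > 0"
    with X obtain N where "\<And>i j. i \<ge> N \<Longrightarrow> j \<ge> N \<Longrightarrow> dist (X i) (X j) < e"
      unfolding Cauchy_def by blast
    moreover have "dist (hcoeff (X i) n) (hcoeff (X j) n) \<le> dist (X i) (X j)" for i j
      unfolding dist_norm using hcoeff_le_norm[of "X i - X j" n] by (simp add: hcoeff_diff)
    ultimately show "\<exists>N. \<forall>i\<ge>N. \<forall>j\<ge>N. dist (hcoeff (X i) n) (hcoeff (X j) n) < e"
      by (meson le_less_trans)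
  qed
  then obtain a where a: "\<And>n. (\<lambda>i. hcoeff (X i) n) \<longlonglongrightarrow> a n"
    unfolding Cauchy_convergent_iff convergent_def by metis
  have bound: "\<exists>N. \<forall>i\<ge>N. \<forall>L. (\<Sum>n<L. (cmod (hcoeff (X i) n - a n))\<^sup>2) \<le> e\<^sup>2" if "e > 0" for e :: real
  proof -
    from X that obtain N where N: "\<And>i j. i \<ge> N \<Longrightarrow> j \<ge> N \<Longrightarrow> dist (X i) (X j) < e"
      unfolding Cauchy_def by blast
    have "(\<Sum>n<L. (cmod (hcoeff (X i) n - a n))\<^sup>2) \<le> e\<^sup>2" if "i \<ge> N" for i L
    proof (rule LIMSEQ_le_const2)
      show "(\<lambda>j. \<Sum>n<L. (cmod (hcoeff (X i) n - hcoeff (X j) n))\<^sup>2)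
          \<longlonglongrightarrow> (\<Sum>n<L. (cmod (hcoeff (X i) n - a n))\<^sup>2)"
        by (intro tendsto_intros a)
      have "(\<Sum>n<L. (cmod (hcoeff (X i) n - hcoeff (X j) n))\<^sup>2) \<le> e\<^sup>2" if "j \<ge> N" for j
      proof -
        have "(\<Sum>n<L. (cmod (hcoeff (X i) n - hcoeff (X j) n))\<^sup>2) \<le> (norm (X i - X j))\<^sup>2"
          using sum_hcoeff_le_norm[of "X i - X j" L] by (simp add: hcoeff_diff)
        also have "\<dots> \<le> e\<^sup>2"
          using N[OF \<open>i \<ge> N\<close> that] by (intro power_mono) (auto simp: dist_norm)
        finally show ?thesis .
      qed
      then show "\<exists>N. \<forall>j\<ge>N. (\<Sum>n<L. (cmod (hcoeff (X i) n - hcoeff (X j) n))\<^sup>2) \<le> e\<^sup>2"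
        by blast
    qed
    then show ?thesis by blast
  qed
  obtain i where i: "\<And>L. (\<Sum>n<L. (cmod (hcoeff (X i) n - a n))\<^sup>2) \<le> 1"
    using bound[of 1] by auto
  \<comment> \<open>The limit \<open>a\<close> is square-summable as the sum of
    \<open>- (X i - a)\<close> and \<open>X i\<close>, taken coefficientwise.\<close>
  have "summable (\<lambda>n. (cmod (- 1 * (hcoeff (X i) n - a n)))\<^sup>2)"
    by (intro summable_norm_sq_cmult summableI_nonneg_bounded[of _ 1] i) auto
  from summable_norm_sq_add[OF this hcoeff_summable[of "X i"]]
  have a2: "hcoeff (hardy_of a) n = a n" for n
    by (intro hcoeff_hardy_of) simp
  have "X \<longlonglongrightarrow> hardy_of a"
  proof (rule LIMSEQ_I)
    fix e :: real assume "e > 0"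
    then obtain N where N: "\<And>i L. i \<ge> N \<Longrightarrow> (\<Sum>n<L. (cmod (hcoeff (X i) n - a n))\<^sup>2) \<le> (e / 2)\<^sup>2"
      using bound[of "e / 2"] by auto
    have "(norm (X i - hardy_of a))\<^sup>2 \<le> (e / 2)\<^sup>2" if "i \<ge> N" for i
      by (rule norm_sq_le_hcoeff) (use N[OF that] in \<open>simp add: hcoeff_diff a2\<close>)
    then have "norm (X i - hardy_of a) < e" if "i \<ge> N" for i
      using that \<open>e > 0\<close> power2_le_imp_le[of "norm (X i - hardy_of a)" "e / 2"] by fastforce
    then show "\<exists>N. \<forall>i\<ge>N. norm (X i - hardy_of a) < e"
      by blast
  qed
  then show "convergent X"
    by (rule convergentI)
qed

section \<open>Shifts and the Szego kernel\<close>

text \<open>Multiplication by z (see \<open>hfun_fshift\<close>), built from coefficients so that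
  membership in the space reduces to a shift of the summation index.\<close>

definition fshift :: "hardy \<Rightarrow> hardy" where
  "fshift f = hardy_of (\<lambda>n. case n of 0 \<Rightarrow> 0 | Suc k \<Rightarrow> hcoeff f k)"

lemma hcoeff_fshift: "hcoeff (fshift f) n = (case n of 0 \<Rightarrow> 0 | Suc k \<Rightarrow> hcoeff f k)"
  unfolding fshift_def
proof (rule hcoeff_hardy_of)
  show "summable (\<lambda>n. (cmod (case n of 0 \<Rightarrow> 0 | Suc k \<Rightarrow> hcoeff f k))\<^sup>2)"
    by (subst summable_Suc_iff[symmetric]) (simp add: hcoeff_summable)
qed

lemma hcoeff_fshift_0 [simp]: "hcoeff (fshift f) 0 = 0"
  and hcoeff_fshift_Suc [simp]: "hcoeff (fshift f) (Suc n) = hcoeff f n"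
  by (simp_all add: hcoeff_fshift)

lemma fshift_add: "fshift (f + g) = fshift f + fshift g"
  and fshift_scaleC: "fshift (c *\<^sub>C f) = c *\<^sub>C fshift f"
  by (rule hardy_eq_coeffI, simp add: hcoeff_fshift hcoeff_add hcoeff_scaleC split: nat.split)+

lemma hcoeff_bshift [simp]: "hcoeff (bshift f) n = hcoeff f (Suc n)"
  unfolding hcoeff_def
proof transfer
  fix f :: "complex \<Rightarrow> complex" and n
  assume "f holomorphic_on ball 0 1 \<and> (\<forall>z. z \<notin> ball 0 1 \<longrightarrow> f z = 0) \<and>
    summable (\<lambda>n. (cmod (taylor f n))\<^sup>2)"
  then show "taylor (\<lambda>z. if z \<in> ball 0 1 then if z = 0 then deriv f 0 else (f z - f 0) / z else 0) n
      = taylor f (Suc n)"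
    using bshift_aux(2)[of f n] by blast
qed

lemma bshift_add: "bshift (f + g) = bshift f + bshift g"
  and bshift_scaleC: "bshift (c *\<^sub>C f) = c *\<^sub>C bshift f"
  by (rule hardy_eq_coeffI, simp add: hcoeff_add hcoeff_scaleC)+

lemma bshift_fshift [simp]: "bshift (fshift f) = f"
  by (rule hardy_eq_coeffI) simp

lemma fshift_bshift: "hfun f 0 = 0 \<Longrightarrow> fshift (bshift f) = f"
  by (rule hardy_eq_coeffI) (simp add: hcoeff_fshift hfun_0 split: nat.split)

text \<open>Reindexing the series costs nothing because the zeroth coefficient of
  \<open>fshift g\<close> vanishes.\<close>

lemma cinner_bshift: "cinner (bshift f) g = cinner f (fshift g)"
proof -
  have "(\<lambda>n. hcoeff f (Suc n) * cnj (hcoeff (fshift g) (Suc n))) sums cinner (bshift f) g"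
    unfolding cinner_def using summable_sums[OF cinner_summable[of "bshift f" g]] by simp
  from sums_Suc[OF this] show ?thesis
    unfolding cinner_def by (simp add: sums_unique)
qed

lemma cinner_fshift_fshift: "cinner (fshift f) (fshift g) = cinner f g"
  by (metis cinner_bshift bshift_fshift)

lemma norm_fshift [simp]: "norm (fshift f) = norm f"
  by (simp add: norm_eq_sqrt_inner inner_hardy_def cinner_fshift_fshift)

lemma norm_fshift_pow [simp]: "norm ((fshift ^^ n) f) = norm f"
  by (induction n) auto

lemma bshift_pow_fshift_pow: "i \<le> n \<Longrightarrow> (bshift ^^ n) ((fshift ^^ i) f) = (bshift ^^ (n - i)) f"
proof (induction i arbitrary: n)
  case (Suc i)
  then obtain k where n: "n = Suc k" by (cases n) auto
  have "(bshift ^^ Suc k) (fshift ((fshift ^^ i) f)) = (bshift ^^ k) ((fshift ^^ i) f)"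
    by (simp add: funpow_Suc_right del: funpow.simps)
  with Suc n show ?case by simp
qed simp

lemma hcoeff_bshift_pow: "hcoeff ((bshift ^^ n) f) k = hcoeff f (n + k)"
  by (induction n arbitrary: k) (simp_all add: hcoeff_bshift)

lemma bshift_pow_add: "(bshift ^^ n) (f + g) = (bshift ^^ n) f + (bshift ^^ n) g"
  and bshift_pow_diff: "(bshift ^^ n) (f - g) = (bshift ^^ n) f - (bshift ^^ n) g"
  and bshift_pow_scaleC: "(bshift ^^ n) (c *\<^sub>C f) = c *\<^sub>C (bshift ^^ n) f"
  by (rule hardy_eq_coeffI, simp add: hcoeff_bshift_pow hcoeff_add hcoeff_diff hcoeff_scaleC)+

lemma bshift_pow_sum: "(bshift ^^ n) (\<Sum>i\<in>A. f i) = (\<Sum>i\<in>A. (bshift ^^ n) (f i))"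
  by (rule hardy_eq_coeffI) (simp add: hcoeff_bshift_pow hcoeff_sum)

lemma norm_bshift_pow_sq: "(norm ((bshift ^^ n) f))\<^sup>2 = (norm f)\<^sup>2 - (\<Sum>i<n. (cmod (hcoeff f i))\<^sup>2)"
  unfolding norm_hardy_sq hcoeff_bshift_pow
  using suminf_split_initial_segment[OF hcoeff_summable[of f], of n] by (simp add: add.commute)

lemma norm_bshift_pow_le: "norm ((bshift ^^ n) f) \<le> norm f"
  by (rule power2_le_imp_le) (simp_all add: norm_bshift_pow_sq sum_nonneg)

text \<open>After \<open>n\<close> backward shifts the squared norm is the tail of the convergent
  series for \<open>(norm f)\<^sup>2\<close>.\<close>

lemma bshift_pow_tendsto_0: "(\<lambda>n. norm ((bshift ^^ n) f)) \<longlonglongrightarrow> 0"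
proof -
  have "(\<lambda>n. \<Sum>i<n. (cmod (hcoeff f i))\<^sup>2) \<longlonglongrightarrow> (norm f)\<^sup>2"
    unfolding norm_hardy_sq by (rule summable_LIMSEQ[OF hcoeff_summable])
  from tendsto_diff[OF tendsto_const[of "(norm f)\<^sup>2"] this]
  have "(\<lambda>n. (norm ((bshift ^^ n) f))\<^sup>2) \<longlonglongrightarrow> 0"
    by (simp add: norm_bshift_pow_sq)
  from tendsto_real_sqrt[OF this] show ?thesis by simp
qed

lemma hfun_fshift [simp]: "hfun (fshift f) z = z * hfun f z"
proof (cases "z \<in> ball 0 1")
  case True
  have "(\<lambda>n. hcoeff (fshift f) (Suc n) * z ^ Suc n) sums (z * hfun f z)"
    using sums_mult[OF hfun_sums[OF True, of f], of z] by (simp add: mult_ac)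
  from sums_Suc[OF this] hfun_sums[OF True, of "fshift f"] show ?thesis
    by (simp add: sums_unique2)
qed (auto simp: hfun_outside)

lemma hfun_fshift_pow: "hfun ((fshift ^^ n) f) z = z ^ n * hfun f z"
  by (induction n) (auto simp: mult_ac)

text \<open>For \<open>w\<close> in the disc this is the reproducing kernel 1 / (1 - cnj w
  z).\<close>

definition szego_kernel :: "complex \<Rightarrow> hardy" where
  "szego_kernel w = hardy_of (\<lambda>n. cnj w ^ n)"

lemma cinner_szego_kernel:
  assumes w: "w \<in> ball 0 1"
  shows "cinner f (szego_kernel w) = hfun f w"
proof -
  have "summable (\<lambda>n. ((cmod w)\<^sup>2) ^ n)"
    using w by (intro summable_geometric) (auto simp: abs_square_less_1)
  then have "summable (\<lambda>n. (cmod (cnj w ^ n))\<^sup>2)"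
    by (simp add: norm_power power_mult[symmetric] mult.commute)
  then have "hcoeff (szego_kernel w) n = cnj w ^ n" for n
    unfolding szego_kernel_def by (rule hcoeff_hardy_of)
  with hfun_sums[OF w, of f] show ?thesis
    by (simp add: cinner_def sums_iff)
qed

lemma hfun_le_norm: "w \<in> ball 0 1 \<Longrightarrow> cmod (hfun f w) \<le> norm f * norm (szego_kernel w)"
  by (metis cinner_szego_kernel cinner_Cauchy_Schwarz)

section \<open>Orthogonal projections\<close>

text \<open>A minimising sequence is Cauchy by the parallelogram law, because midpoints of elements
  of \<open>M\<close> cannot be closer to \<open>f\<close> than the distance \<open>d\<close>; its
  limit is the projection.\<close>

lemma orthogonal_projection_exists:
  assumes sub: "hardy.subspace M" and cl: "closed M"
  shows "\<exists>p\<in>M. \<forall>g\<in>M. cinner (f - p) g = 0"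
proof -
  define d where "d = Inf ((\<lambda>g. norm (f - g)) ` M)"
  have bdd: "bdd_below ((\<lambda>g. norm (f - g)) ` M)"
    by (intro bdd_belowI[of _ 0]) auto
  have 0: "0 \<in> M" using sub by (rule hardy.subspace_0)
  have d_le: "d \<le> norm (f - g)" if "g \<in> M" for g
    unfolding d_def using bdd that by (intro cInf_lower) auto
  have d_nonneg: "0 \<le> d"
    unfolding d_def using 0 by (intro cInf_greatest) auto
  have "\<exists>g\<in>M. norm (f - g) < d + e" if "e > 0" for e
    using that cInf_lessD[of "(\<lambda>g. norm (f - g)) ` M" "d + e"] 0 unfolding d_def by auto
  then have "\<exists>g\<in>M. norm (f - g) < d + 1 / Suc n" for n
    by simp
  then obtain X where X: "\<And>n. X n \<in> M" and Xd: "\<And>n. norm (f - X n) < d + 1 / Suc n"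
    by metis
  have lim_norm: "(\<lambda>n. norm (f - X n)) \<longlonglongrightarrow> d"
  proof (rule tendsto_sandwich[where f = "\<lambda>_. d" and h = "\<lambda>n. d + 1 / Suc n"])
    show "(\<lambda>n. d + 1 / Suc n) \<longlonglongrightarrow> d"
      using tendsto_add[OF tendsto_const LIMSEQ_inverse_real_of_nat, of d] by (simp add: inverse_eq_divide)
    show "\<forall>\<^sub>F n in sequentially. norm (f - X n) \<le> d + 1 / Suc n"
      using Xd by (intro always_eventually allI less_imp_le)
    show "\<forall>\<^sub>F n in sequentially. d \<le> norm (f - X n)"
      using d_le X by (intro always_eventually) auto
  qed simp
  have half: "(1 / 2) *\<^sub>R (a + b) \<in> M" if "a \<in> M" "b \<in> M" for a b
    unfolding scaleR_hardy_def
    using that sub by (intro hardy.subspace_scale hardy.subspace_add)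
  have para: "(norm (X i - X j))\<^sup>2 \<le> 2 * ((norm (f - X i))\<^sup>2 - d\<^sup>2) + 2 * ((norm (f - X j))\<^sup>2 - d\<^sup>2)" for i j
  proof -
    let ?a = "f - X i" and ?b = "f - X j"
    have "?a + ?b = 2 *\<^sub>R (f - (1 / 2) *\<^sub>R (X i + X j))"
      by (simp add: scaleR_diff_right scaleR_2)
    then have "norm (?a + ?b) = 2 * norm (f - (1 / 2) *\<^sub>R (X i + X j))"
      by simp
    moreover have "d \<le> norm (f - (1 / 2) *\<^sub>R (X i + X j))"
      by (intro d_le half X)
    ultimately have "(2 * d)\<^sup>2 \<le> (norm (?a + ?b))\<^sup>2"
      using d_nonneg by (intro power_mono) auto
    moreover have "(norm (X i - X j))\<^sup>2 = (norm (?a - ?b))\<^sup>2"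
      by (simp add: norm_minus_commute)
    ultimately show ?thesis
      unfolding norm_diff_sq_hardy[of ?a ?b] norm_add_sq_hardy[of ?a ?b] by (simp add: power_mult_distrib)
  qed
  have "Cauchy X"
  proof (rule metric_CauchyI)
    fix e :: real assume e: "e > 0"
    have "(\<lambda>n. (norm (f - X n))\<^sup>2) \<longlonglongrightarrow> d\<^sup>2"
      by (intro tendsto_intros lim_norm)
    then have "\<forall>\<^sub>F n in sequentially. (norm (f - X n))\<^sup>2 < d\<^sup>2 + e\<^sup>2 / 4"
      using e by (auto intro: order_tendstoD)
    then obtain N where N: "\<And>n. n \<ge> N \<Longrightarrow> (norm (f - X n))\<^sup>2 < d\<^sup>2 + e\<^sup>2 / 4"
      unfolding eventually_sequentially by blast
    have "dist (X i) (X j) < e" if "i \<ge> N" "j \<ge> N" for i j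
    proof -
      have "(norm (X i - X j))\<^sup>2 < e\<^sup>2"
        using para[of i j] N[OF that(1)] N[OF that(2)] unfolding right_diff_distrib by linarith
      then show ?thesis
        unfolding dist_norm using e by (intro power2_less_imp_less[of _ e]) auto
    qed
    then show "\<exists>N. \<forall>i\<ge>N. \<forall>j\<ge>N. dist (X i) (X j) < e" by blast
  qed
  then obtain p where p: "X \<longlonglongrightarrow> p"
    using Cauchy_convergent_iff convergent_def by blast
  have "p \<in> M"
    using closed_sequentially[OF cl X p] .
  have "(\<lambda>n. norm (f - X n)) \<longlonglongrightarrow> norm (f - p)"
    by (intro tendsto_intros p)
  with lim_norm have dp: "norm (f - p) = d"
    by (rule LIMSEQ_unique[rotated])
  have "cinner (f - p) g = 0" if "g \<in> M" for g
  proof (cases "norm g = 0")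
    case False
    \<comment> \<open>Adding this multiple of \<open>g\<close> to \<open>p\<close> lowers the
      squared distance to \<open>f\<close> by \<open>(cmod a * norm g)\<^sup>2\<close>, which
      minimality of \<open>d\<close> forces to be 0.\<close>
    define a where "a = cinner (f - p) g / of_real ((norm g)\<^sup>2)"
    have "p + a *\<^sub>C g \<in> M"
      using \<open>p \<in> M\<close> that sub by (intro hardy.subspace_add hardy.subspace_scale)
    then have "d\<^sup>2 \<le> (norm (f - (p + a *\<^sub>C g)))\<^sup>2"
      using d_nonneg by (intro power_mono d_le)
    also have "\<dots> = (norm ((f - p) - a *\<^sub>C g))\<^sup>2"
      by (simp add: algebra_simps)
    also have "\<dots> = d\<^sup>2 + (cmod a * norm g)\<^sup>2 - 2 * Re (cnj a * cinner (f - p) g)"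
      by (simp add: norm_diff_sq_hardy dp norm_scaleC cinner_scaleC_right)
    also have "cnj a * cinner (f - p) g = of_real ((cmod a * norm g)\<^sup>2)"
    proof -
      have "cinner (f - p) g = a * of_real ((norm g)\<^sup>2)"
        using False by (simp add: a_def)
      then have "cnj a * cinner (f - p) g = (a * cnj a) * of_real ((norm g)\<^sup>2)"
        by simp
      then show ?thesis
        by (simp only: complex_norm_square[symmetric]) (simp add: power_mult_distrib)
    qed
    finally have "cmod a * norm g = 0" by simp
    with False show ?thesis by (simp add: a_def)
  qed auto
  with \<open>p \<in> M\<close> show ?thesis by blast
qed

text \<open>A choice made for any set; \<open>hproj_unique\<close> identifies it when
  \<open>M\<close> is a closed subspace.\<close>

definition hproj :: "hardy set \<Rightarrow> hardy \<Rightarrow> hardy" where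
  "hproj M f = (SOME p. p \<in> M \<and> (\<forall>g\<in>M. cinner (f - p) g = 0))"

locale closed_subspace =
  fixes M :: "hardy set"
  assumes subspace: "hardy.subspace M" and closed: "closed M"
begin

lemma hproj_mem [simp]: "hproj M f \<in> M"
  and hproj_orth: "g \<in> M \<Longrightarrow> cinner (f - hproj M f) g = 0"
  using someI_ex[of "\<lambda>p. p \<in> M \<and> (\<forall>g\<in>M. cinner (f - p) g = 0)"]
    orthogonal_projection_exists[OF subspace closed, of f]
  unfolding hproj_def by blast+

lemma hproj_unique:
  assumes "p \<in> M" "\<And>g. g \<in> M \<Longrightarrow> cinner (f - p) g = 0"
  shows "hproj M f = p"
proof -
  let ?q = "hproj M f - p"
  have q: "?q \<in> M" using assms(1) subspace by (intro hardy.subspace_diff) auto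
  have "cinner ?q ?q = cinner (f - p) ?q - cinner (f - hproj M f) ?q"
    by (simp add: cinner_diff_left)
  also have "\<dots> = 0" using assms(2) q hproj_orth by simp
  finally show ?thesis by (simp add: cinner_self_norm)
qed

lemma hproj_add: "hproj M (f + g) = hproj M f + hproj M g"
proof (rule hproj_unique)
  show "hproj M f + hproj M g \<in> M"
    using subspace by (intro hardy.subspace_add) auto
  show "cinner (f + g - (hproj M f + hproj M g)) h = 0" if "h \<in> M" for h
    using hproj_orth[OF that, of f] hproj_orth[OF that, of g]
    by (simp add: cinner_diff_left cinner_add_left)
qed

lemma hproj_scaleC: "hproj M (c *\<^sub>C f) = c *\<^sub>C hproj M f"
proof (rule hproj_unique)
  show "c *\<^sub>C hproj M f \<in> M"
    using subspace by (intro hardy.subspace_scale) auto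
  show "cinner (c *\<^sub>C f - c *\<^sub>C hproj M f) h = 0" if "h \<in> M" for h
    using hproj_orth[OF that, of f]
    by (simp add: cinner_diff_left cinner_scaleC_left)
qed

lemma cinner_hproj: "g \<in> M \<Longrightarrow> cinner (hproj M f) g = cinner f g"
  and cinner_hproj_right: "g \<in> M \<Longrightarrow> cinner g (hproj M f) = cinner g f"
  using hproj_orth[of g f] cinner_commute[of g "hproj M f"] cinner_commute[of g f]
  by (simp_all add: cinner_diff_left)

end

section \<open>Powers of the shift and truncated sums\<close>

lemma fshift_pow_add: "(fshift ^^ n) (f + g) = (fshift ^^ n) f + (fshift ^^ n) g"
  and fshift_pow_scaleC: "(fshift ^^ n) (c *\<^sub>C f) = c *\<^sub>C (fshift ^^ n) f"
  by (induction n) (simp_all add: fshift_add fshift_scaleC)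

lemma fshift_pow_zero [simp]: "(fshift ^^ n) 0 = 0"
  using fshift_pow_scaleC[of n 0 0] by simp

lemma fshift_pow_sum: "(fshift ^^ n) (\<Sum>i\<in>A. f i) = (\<Sum>i\<in>A. (fshift ^^ n) (f i))"
  by (induction A rule: infinite_finite_induct) (simp_all add: fshift_pow_add)

lemma fshift_sum: "fshift (\<Sum>i\<in>A. f i) = (\<Sum>i\<in>A. fshift (f i))"
  using fshift_pow_sum[of 1 f A] by simp

lemma hcoeff_fshift_pow_less: "l < n \<Longrightarrow> hcoeff ((fshift ^^ n) f) l = 0"
proof (induction n arbitrary: l)
  case (Suc n)
  then show ?case by (cases l) simp_all
qed simp

lemma hcoeff_tendsto_norm_sq: "(\<lambda>L. \<Sum>l<L. (cmod (hcoeff f l))\<^sup>2) \<longlonglongrightarrow> (norm f)\<^sup>2"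
  unfolding norm_hardy_sq by (rule summable_LIMSEQ[OF hcoeff_summable])

text \<open>Cauchy-Schwarz for the first \<open>L\<close> coefficients. The bound is independent of
  \<open>L\<close>, as the energy estimate below is made on truncations first.\<close>

lemma partial_cinner_le: "cmod (\<Sum>l<L. cnj (hcoeff f l) * hcoeff g l) \<le> norm f * norm g"
proof -
  have le: "L2_set (\<lambda>l. cmod (hcoeff u l)) {..<L} \<le> norm u" for u
    unfolding L2_set_def using sum_hcoeff_le_norm[where f = u and L = L] by (intro real_le_lsqrt) auto
  have "cmod (\<Sum>l<L. cnj (hcoeff f l) * hcoeff g l) \<le> (\<Sum>l<L. \<bar>cmod (hcoeff f l)\<bar> * \<bar>cmod (hcoeff g l)\<bar>)"
    by (rule order_trans[OF norm_sum]) (simp add: norm_mult)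
  also have "\<dots> \<le> L2_set (\<lambda>l. cmod (hcoeff f l)) {..<L} * L2_set (\<lambda>l. cmod (hcoeff g l)) {..<L}"
    by (rule L2_set_mult_ineq)
  also have "\<dots> \<le> norm f * norm g"
    by (intro mult_mono le) auto
  finally show ?thesis .
qed

section \<open>Contractions modelled by the backward shift\<close>

text \<open>Collects what the iteration uses. \<open>C\<close> is a contraction on \<open>M\<close>
  with adjoint \<open>Cs\<close>; \<open>energy\<close> says that its defect has finite rank and is
  carried by the vectors \<open>v j\<close>, and \<open>recon\<close> splits one factor z off
  \<open>f\<close>. Linearity is assumed on the whole space, adjointness and the two identities on
  \<open>M\<close>.\<close>

locale shift_model = closed_subspace +
  fixes C Cs :: "hardy \<Rightarrow> hardy" and I :: "nat set" and v F :: "nat \<Rightarrow> hardy"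
  assumes finite_I: "finite I"
    and C_mem: "f \<in> M \<Longrightarrow> C f \<in> M"
    and Cs_mem: "f \<in> M \<Longrightarrow> Cs f \<in> M"
    and v_mem: "j \<in> I \<Longrightarrow> v j \<in> M"
    and C_add: "C (f + g) = C f + C g"
    and C_scaleC: "C (c *\<^sub>C f) = c *\<^sub>C C f"
    and C_adj: "f \<in> M \<Longrightarrow> g \<in> M \<Longrightarrow> cinner (C f) g = cinner f (Cs g)"
    and energy: "f \<in> M \<Longrightarrow> (norm f)\<^sup>2 = (norm (C f))\<^sup>2 + (\<Sum>j\<in>I. (cmod (cinner f (v j)))\<^sup>2)"
    and recon: "f \<in> M \<Longrightarrow> f = (\<Sum>j\<in>I. cinner f (v j) *\<^sub>C F j) + fshift (C f)"
begin

section \<open>Powers of the contraction and their coefficients\<close>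

lemma C_pow_add: "(C ^^ n) (f + g) = (C ^^ n) f + (C ^^ n) g"
  and C_pow_scaleC: "(C ^^ n) (c *\<^sub>C f) = c *\<^sub>C (C ^^ n) f"
  by (induction n) (simp_all add: C_add C_scaleC)

lemma C_pow_zero [simp]: "(C ^^ n) 0 = 0"
  using C_pow_scaleC[of n 0 0] by simp

lemma C_pow_diff: "(C ^^ n) (f - g) = (C ^^ n) f - (C ^^ n) g"
  unfolding minus_hardy_def C_pow_add C_pow_scaleC ..

lemma C_pow_sum: "(C ^^ n) (\<Sum>i\<in>A. f i) = (\<Sum>i\<in>A. (C ^^ n) (f i))"
  by (induction A rule: infinite_finite_induct) (simp_all add: C_pow_add)

lemma C_sum: "C (\<Sum>i\<in>A. f i) = (\<Sum>i\<in>A. C (f i))"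
  using C_pow_sum[of 1 f A] by simp

lemma C_pow_mem: "f \<in> M \<Longrightarrow> (C ^^ n) f \<in> M"
  by (induction n) (simp_all add: C_mem)

lemma Cs_pow_mem: "f \<in> M \<Longrightarrow> (Cs ^^ n) f \<in> M"
  by (induction n) (simp_all add: Cs_mem)

lemma C_pow_adj: "f \<in> M \<Longrightarrow> g \<in> M \<Longrightarrow> cinner ((C ^^ n) f) g = cinner f ((Cs ^^ n) g)"
  by (induction n arbitrary: g) (simp_all add: C_adj C_pow_mem Cs_mem funpow_swap1[of Cs])

lemma norm_C_le: "f \<in> M \<Longrightarrow> norm (C f) \<le> norm f"
  by (rule power2_le_imp_le) (simp_all add: energy[of f] sum_nonneg)

lemma C_pow_decseq: "f \<in> M \<Longrightarrow> decseq (\<lambda>n. norm ((C ^^ n) f))"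
  by (rule decseq_SucI) (simp add: norm_C_le C_pow_mem)

lemma norm_C_pow_le: "f \<in> M \<Longrightarrow> norm ((C ^^ n) f) \<le> norm f"
  using decseqD[OF C_pow_decseq, of f 0 n] by simp

text \<open>The \<open>n\<close>-th Taylor coefficient of the function that multiplies
  \<open>F j\<close> in the representation of \<open>f\<close>.\<close>

definition coef :: "hardy \<Rightarrow> nat \<Rightarrow> nat \<Rightarrow> complex" where
  "coef f j n = cinner ((C ^^ n) f) (v j)"

lemma coef_add: "coef (f + g) j n = coef f j n + coef g j n"
  and coef_scaleC: "coef (c *\<^sub>C f) j n = c * coef f j n"
  and coef_C_pow: "coef ((C ^^ p) f) j n = coef f j (n + p)"
  by (simp_all add: coef_def C_pow_add C_pow_scaleC cinner_add_left cinner_scaleC_left funpow_add)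

lemma coef_le:
  assumes "f \<in> M" "j \<in> I"
  shows "cmod (coef f j n) \<le> norm f"
proof -
  let ?g = "(C ^^ n) f"
  have g: "?g \<in> M" using assms by (simp add: C_pow_mem)
  have "(cmod (cinner ?g (v j)))\<^sup>2 \<le> (\<Sum>j\<in>I. (cmod (cinner ?g (v j)))\<^sup>2)"
    using assms finite_I by (intro member_le_sum) auto
  also have "\<dots> \<le> (norm ?g)\<^sup>2"
    using energy[OF g] by simp
  finally have "cmod (coef f j n) \<le> norm ?g"
    unfolding coef_def by (rule power2_le_imp_le) simp
  also have "\<dots> \<le> norm f"
    using assms by (intro norm_C_pow_le)
  finally show ?thesis .
qed

text \<open>The energy identity telescopes along the orbit of \<open>f\<close>. The term with
  \<open>(C ^^ n) f\<close> is what has to tend to 0 for the representation to be isometric.\<close>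

lemma energy_pow:
  "f \<in> M \<Longrightarrow> (norm f)\<^sup>2 = (norm ((C ^^ n) f))\<^sup>2 + (\<Sum>i<n. \<Sum>j\<in>I. (cmod (coef f j i))\<^sup>2)"
proof (induction n)
  case (Suc n)
  then show ?case
    using energy[of "(C ^^ n) f"] by (simp add: C_pow_mem coef_def)
qed simp

lemma coef_summable:
  assumes "f \<in> M" "j \<in> I"
  shows "summable (\<lambda>i. (cmod (coef f j i))\<^sup>2)"
proof (rule summableI_nonneg_bounded)
  fix n
  have "(\<Sum>i<n. (cmod (coef f j i))\<^sup>2) \<le> (\<Sum>i<n. \<Sum>j\<in>I. (cmod (coef f j i))\<^sup>2)"
    using assms finite_I by (intro sum_mono member_le_sum) auto
  also have "\<dots> \<le> (norm f)\<^sup>2"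
    using energy_pow[OF assms(1), of n] by simp
  finally show "(\<Sum>i<n. (cmod (coef f j i))\<^sup>2) \<le> (norm f)\<^sup>2" .
qed simp

lemma coef_tendsto_0: "f \<in> M \<Longrightarrow> j \<in> I \<Longrightarrow> (\<lambda>i. cmod (coef f j i)) \<longlonglongrightarrow> 0"
  using tendsto_real_sqrt[OF summable_LIMSEQ_zero[OF coef_summable]] by simp

text \<open>\<open>G\<close> multiplied by the \<open>n\<close>-th partial sum of the power series
  with coefficients \<open>coef f j\<close>.\<close>

definition psum :: "hardy \<Rightarrow> nat \<Rightarrow> nat \<Rightarrow> hardy \<Rightarrow> hardy" where
  "psum f j n G = (\<Sum>i<n. coef f j i *\<^sub>C (fshift ^^ i) G)"

lemma psum_add: "psum f j n (G + H) = psum f j n G + psum f j n H"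
  by (simp add: psum_def fshift_pow_add hardy.scale_right_distrib sum.distrib)

lemma recon_pow:
  "f \<in> M \<Longrightarrow> f = (\<Sum>j\<in>I. psum f j n (F j)) + (fshift ^^ n) ((C ^^ n) f)"
proof (induction n)
  case (Suc n)
  let ?g = "(C ^^ n) f"
  have "(fshift ^^ n) ?g = (fshift ^^ n) ((\<Sum>j\<in>I. cinner ?g (v j) *\<^sub>C F j) + fshift (C ?g))"
    using recon[of ?g] Suc.prems by (simp add: C_pow_mem)
  also have "\<dots> = (\<Sum>j\<in>I. coef f j n *\<^sub>C (fshift ^^ n) (F j)) + (fshift ^^ Suc n) ((C ^^ Suc n) f)"
    by (simp add: fshift_pow_add fshift_pow_sum fshift_pow_scaleC coef_def funpow_swap1)
  finally show ?case
    using Suc.IH[OF Suc.prems] by (simp add: psum_def sum.distrib add.assoc)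
qed (simp add: psum_def)

text \<open>Each further summand has norm at most \<open>norm f * norm G\<close>, as the shift is
  isometric. Moving the cut-off by a fixed amount therefore costs a constant independent of
  \<open>n\<close>.\<close>

lemma norm_psum_add_le:
  assumes "f \<in> M" "j \<in> I"
  shows "norm (psum f j (n + k) G) \<le> norm (psum f j n G) + real k * (norm f * norm G)"
proof (induction k)
  case (Suc k)
  have "norm (psum f j (n + Suc k) G) \<le> norm (psum f j (n + k) G) + norm (coef f j (n + k) *\<^sub>C (fshift ^^ (n + k)) G)"
    by (simp add: psum_def norm_triangle_ineq)
  also have "norm (coef f j (n + k) *\<^sub>C (fshift ^^ (n + k)) G) \<le> norm f * norm G"
    unfolding norm_scaleC norm_fshift_pow using assms by (intro mult_right_mono coef_le) auto
  finally show ?case using Suc.IH by (simp add: algebra_simps)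
qed simp

text \<open>Once the factor z^p is taken out, the later terms form the partial sum belonging to
  \<open>(C ^^ p) f\<close>.\<close>

lemma psum_split:
  "psum f j (p + n) G = psum f j p G + (fshift ^^ p) (\<Sum>i<n. coef f j (i + p) *\<^sub>C (fshift ^^ i) G)"
proof (induction n)
  case (Suc n)
  have "(fshift ^^ (p + n)) G = (fshift ^^ p) ((fshift ^^ n) G)"
    by (simp add: funpow_add)
  with Suc show ?case
    by (simp add: psum_def fshift_pow_add fshift_pow_scaleC add.assoc add.commute[of n])
qed (simp add: psum_def)

text \<open>
  \<open>Y n\<close> is the coefficient sequence of \<open>(\<Sum>\<^sub>i\<^sub><\<^sub>n S\<^sup>i \<otimes> C\<^sup>i) (G \<otimes> h)\<close>. Since
  \<open>Y (n + 1) = G \<otimes> h + (S \<otimes> C) (Y n)\<close>, the energy identity bounds the \<open>n\<close>-th term by the decrement of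
  \<open>\<parallel>Y n\<parallel>\<^sup>2\<close> plus a cross term, in which \<open>h = C\<^sup>*\<^sup>p v\<^sub>q\<close> turns the pairing with \<open>h\<close> into shifted coefficients.
\<close>

lemma sum_norm_psum_sq_le:
  fixes p q N :: nat and G :: hardy
  assumes q: "q \<in> I" and h: "h = (Cs ^^ p) (v q)"
  shows "(\<Sum>n<N. \<Sum>j\<in>I. (norm (psum h j n G))\<^sup>2)
    \<le> 2 * (\<Sum>n<N. norm G * norm (\<Sum>i<Suc n. coef h q (i + p) *\<^sub>C (fshift ^^ i) G))"
proof -
  define D where "D n = (\<Sum>i<Suc n. coef h q (i + p) *\<^sub>C (fshift ^^ i) G)" for n
  define Y where "Y n l = (\<Sum>i<n. hcoeff ((fshift ^^ i) G) l *\<^sub>C (C ^^ i) h)" for n l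
  have hM: "h \<in> M" using h q by (simp add: Cs_pow_mem v_mem)
  have YM: "Y n l \<in> M" for n l
    unfolding Y_def using subspace hM
    by (intro hardy.subspace_sum hardy.subspace_scale C_pow_mem)
  have C_coef: "cinner ((C ^^ p) ((C ^^ i) h)) (v q) = coef h q (i + p)" for i
    by (simp add: coef_def add.commute[of i] funpow_add)
  have Y_v: "cinner (Y n l) (v j) = hcoeff (psum h j n G) l" for n l j
    by (simp add: Y_def psum_def cinner_sum_left cinner_scaleC_left hcoeff_sum hcoeff_scaleC coef_def mult.commute)
  have Y_Suc_0: "Y (Suc n) 0 = hcoeff G 0 *\<^sub>C h" for n
    unfolding Y_def sum.lessThan_Suc_shift by simp
  have Y_Suc_Suc: "Y (Suc n) (Suc l) = hcoeff G (Suc l) *\<^sub>C h + C (Y n l)" for n l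
    unfolding Y_def sum.lessThan_Suc_shift by (simp add: C_scaleC C_sum)
  \<comment> \<open>Only the first \<open>L\<close> coefficients are summed at this stage, so that
    all sums are finite; \<open>L\<close> tends to infinity at the end.\<close>
  have "(\<Sum>l<L. \<Sum>n<N. \<Sum>j\<in>I. (cmod (hcoeff (psum h j n G) l))\<^sup>2) \<le> 2 * (\<Sum>n<N. norm G * norm (D n))" for L
  proof -
    define E where "E n = (\<Sum>l<L. (norm (Y n l))\<^sup>2)" for n
    define A where "A n = (\<Sum>l<L. \<Sum>j\<in>I. (cmod (hcoeff (psum h j n G) l))\<^sup>2)" for n
    have A: "A n \<le> E n - E (Suc n) + 2 * (norm G * norm (D n))" for n
    proof -
      have cross: "cinner (Y (Suc n) l) (hcoeff G l *\<^sub>C h) = cnj (hcoeff G l) * hcoeff (D n) l" for l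
      proof -
        have "cinner (Y (Suc n) l) h = cinner ((C ^^ p) (Y (Suc n) l)) (v q)"
          unfolding h using YM q by (simp add: C_pow_adj v_mem)
        also have "\<dots> = hcoeff (D n) l"
          by (simp add: Y_def D_def C_pow_sum C_pow_scaleC cinner_sum_left cinner_scaleC_left
              hcoeff_sum hcoeff_scaleC C_coef mult.commute del: sum.lessThan_Suc)
        finally show ?thesis by (simp add: cinner_scaleC_right)
      qed
      have "E (Suc n) - 2 * (norm G * norm (D n)) \<le> E (Suc n) - 2 * Re (\<Sum>l<L. cnj (hcoeff G l) * hcoeff (D n) l)"
        using partial_cinner_le[where f = G and g = "D n" and L = L] complex_Re_le_cmod[of "\<Sum>l<L. cnj (hcoeff G l) * hcoeff (D n) l"]
        by linarith
      \<comment> \<open>When the squares are expanded, the squared norms of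
        \<open>hcoeff G l *\<^sub>C h\<close> are nonnegative and only enlarge the right
        side.\<close>
      also have "\<dots> \<le> (\<Sum>l<L. (norm (Y (Suc n) l - hcoeff G l *\<^sub>C h))\<^sup>2)"
        unfolding norm_diff_sq_hardy cross sum_subtractf sum.distrib E_def
        by (simp add: sum_distrib_left sum_nonneg)
      \<comment> \<open>Subtracting \<open>hcoeff G l *\<^sub>C h\<close> leaves 0 at index 0 and
        \<open>C (Y n l)\<close> at index \<open>Suc l\<close>, so the truncation loses exactly the
        term with \<open>l = L - 1\<close>.\<close>
      also have "\<dots> \<le> (\<Sum>l<L. (norm (C (Y n l)))\<^sup>2)"
      proof (cases L)
        case (Suc K)
        have "(\<Sum>l<Suc K. (norm (Y (Suc n) l - hcoeff G l *\<^sub>C h))\<^sup>2) = (\<Sum>l<K. (norm (C (Y n l)))\<^sup>2)"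
          unfolding sum.lessThan_Suc_shift Y_Suc_0 Y_Suc_Suc by simp
        then show ?thesis by (simp add: Suc)
      qed simp
      also have "\<dots> = E n - A n"
        unfolding E_def A_def using energy[OF YM] by (simp add: Y_v sum_subtractf[symmetric])
      finally show ?thesis by simp
    qed
    have "(\<Sum>n<N. A n) \<le> (\<Sum>n<N. E n - E (Suc n)) + 2 * (\<Sum>n<N. norm G * norm (D n))"
      unfolding sum_distrib_left sum.distrib[symmetric] by (rule sum_mono) (rule A)
    also have "(\<Sum>n<N. E n - E (Suc n)) = E 0 - E N"
      by (rule sum_lessThan_telescope')
    \<comment> \<open>\<open>Y 0\<close> is an empty sum, so \<open>E 0\<close> is 0.\<close>
    also have "E 0 - E N \<le> 0"
      by (simp add: E_def Y_def sum_nonneg)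
    finally show ?thesis
      unfolding A_def by (subst sum.swap) simp
  qed
  moreover have "(\<lambda>L. \<Sum>l<L. \<Sum>n<N. \<Sum>j\<in>I. (cmod (hcoeff (psum h j n G) l))\<^sup>2)
      \<longlonglongrightarrow> (\<Sum>n<N. \<Sum>j\<in>I. (norm (psum h j n G))\<^sup>2)"
  proof -
    have "(\<Sum>l<L. \<Sum>n<N. \<Sum>j\<in>I. (cmod (hcoeff (psum h j n G) l))\<^sup>2)
        = (\<Sum>n<N. \<Sum>j\<in>I. \<Sum>l<L. (cmod (hcoeff (psum h j n G) l))\<^sup>2)" for L
    proof -
      have "(\<Sum>l<L. \<Sum>n<N. \<Sum>j\<in>I. (cmod (hcoeff (psum h j n G) l))\<^sup>2)
          = (\<Sum>n<N. \<Sum>l<L. \<Sum>j\<in>I. (cmod (hcoeff (psum h j n G) l))\<^sup>2)"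
        by (rule sum.swap)
      also have "\<dots> = (\<Sum>n<N. \<Sum>j\<in>I. \<Sum>l<L. (cmod (hcoeff (psum h j n G) l))\<^sup>2)"
        by (rule sum.cong[OF refl], rule sum.swap)
      finally show ?thesis .
    qed
    then show ?thesis
      by (simp only:) (intro tendsto_sum hcoeff_tendsto_norm_sq)
  qed
  ultimately show ?thesis
    unfolding D_def by (intro LIMSEQ_le_const2) auto
qed

text \<open>\<open>sum_norm_psum_sq_le\<close> bounds the sum by norms of partial sums whose indices
  are shifted by \<open>p\<close>. These differ from the partial sums on the left by a number of
  terms independent of \<open>n\<close>, so half of the left side absorbs them and a bound linear in
  \<open>N\<close> remains.\<close>

lemma cesaro_bound:
  assumes q: "q \<in> I" and h: "h = (Cs ^^ p) (v q)"
  obtains B where "B \<ge> 0"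
    "\<And>G N. (\<Sum>n<N. \<Sum>j\<in>I. (norm (psum h j n G))\<^sup>2) \<le> B * real N * (norm G)\<^sup>2"
proof
  have hM: "h \<in> M" using h q by (simp add: Cs_pow_mem v_mem)
  \<comment> \<open>Of the \<open>2 * p + 1\<close> summands, \<open>p + 1\<close> extend the
    cut-off from \<open>n\<close> to \<open>n + Suc p\<close> and \<open>p\<close> make up the
    initial block split off by \<open>psum_split\<close>.\<close>
  define c where "c = real (2 * p + 1) * norm h"
  show "4 + 4 * c \<ge> 0" by (simp add: c_def)
  fix G :: hardy and N :: nat
  let ?A = "\<lambda>n. \<Sum>j\<in>I. (norm (psum h j n G))\<^sup>2"
  let ?D = "\<lambda>n. \<Sum>i<Suc n. coef h q (i + p) *\<^sub>C (fshift ^^ i) G"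
  have step: "2 * (norm G * norm (?D n)) \<le> ?A n / 2 + (2 + 2 * c) * (norm G)\<^sup>2" for n
  proof -
    have "norm (?D n) = norm ((fshift ^^ p) (?D n))" by simp
    also have "\<dots> = norm (psum h q (n + Suc p) G - psum h q (0 + p) G)"
      using psum_split[of h q p "Suc n" G] by (simp add: algebra_simps)
    also have "\<dots> \<le> norm (psum h q (n + Suc p) G) + norm (psum h q (0 + p) G)"
      by (rule norm_triangle_ineq4)
    also have "\<dots> \<le> (norm (psum h q n G) + real (Suc p) * (norm h * norm G))
        + (norm (psum h q 0 G) + real p * (norm h * norm G))"
      by (intro add_mono norm_psum_add_le hM q)
    also have "\<dots> = norm (psum h q n G) + c * norm G"
      by (simp add: c_def psum_def algebra_simps)
    finally have "norm G * norm (?D n) \<le> norm G * (norm (psum h q n G) + c * norm G)"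
      by (intro mult_left_mono) auto
    \<comment> \<open>The weights are chosen so that only half of \<open>?A n\<close> appears, which
      can be moved to the left side.\<close>
    moreover have "2 * (norm G * norm (psum h q n G)) \<le> 2 * (norm G)\<^sup>2 + (norm (psum h q n G))\<^sup>2 / 2"
      using sum_squares_bound[of "2 * norm G" "norm (psum h q n G)"]
      by (simp add: power_mult_distrib)
    moreover have "(norm (psum h q n G))\<^sup>2 \<le> ?A n"
      using q finite_I by (intro member_le_sum[where f = "\<lambda>j. (norm (psum h j n G))\<^sup>2"]) auto
    ultimately show ?thesis
      by (simp add: algebra_simps power2_eq_square)
  qed
  have "(\<Sum>n<N. ?A n) \<le> (\<Sum>n<N. 2 * (norm G * norm (?D n)))"
    using sum_norm_psum_sq_le[OF q h, where N = N and G = G] by (simp add: sum_distrib_left)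
  also have "\<dots> \<le> (\<Sum>n<N. ?A n / 2 + (2 + 2 * c) * (norm G)\<^sup>2)"
    by (rule sum_mono) (rule step)
  also have "\<dots> = (\<Sum>n<N. ?A n) / 2 + real N * ((2 + 2 * c) * (norm G)\<^sup>2)"
    by (simp add: sum.distrib sum_divide_distrib)
  finally show "(\<Sum>n<N. ?A n) \<le> (4 + 4 * c) * real N * (norm G)\<^sup>2"
    by (simp add: algebra_simps)
qed

text \<open>\<open>P\<close> is a polynomial of degree less than \<open>L\<close>. Since
  \<open>n\<close> backward shifts turn the \<open>i\<close>-th summand into a multiple of
  \<open>(bshift ^^ (n - i)) P\<close>, at most the last \<open>L\<close> summands survive, and
  their coefficients tend to 0.\<close>

lemma bshift_pow_psum_tendsto_0:
  assumes f: "f \<in> M" "j \<in> I" and P: "(bshift ^^ L) P = 0"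
  shows "(\<lambda>n. norm ((bshift ^^ n) (psum f j n P))) \<longlonglongrightarrow> 0"
proof (rule real_tendsto_sandwich[where f = "\<lambda>_. 0"
      and h = "\<lambda>n. \<Sum>k<L. cmod (coef f j (n - Suc k)) * norm P"])
  have bP: "(bshift ^^ k) P = 0" if "L \<le> k" for k
    using that by (intro hardy_eq_coeffI)
      (metis P hcoeff_bshift_pow hcoeff_zero le_add_diff_inverse add.assoc)
  have bound: "norm ((bshift ^^ n) (psum f j n P)) \<le> (\<Sum>k<L. cmod (coef f j (n - Suc k)) * norm P)"
    if n: "n \<ge> L" for n
  proof -
    have "(bshift ^^ n) (psum f j n P) = (\<Sum>i<n. coef f j i *\<^sub>C (bshift ^^ (n - i)) P)"
      by (simp add: psum_def bshift_pow_sum bshift_pow_scaleC bshift_pow_fshift_pow)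
    \<comment> \<open>The substitution \<open>i = n - Suc k\<close> counts the summands from the
      top, so that a fixed number of them remains.\<close>
    also have "\<dots> = (\<Sum>k<n. coef f j (n - Suc k) *\<^sub>C (bshift ^^ Suc k) P)"
      by (subst sum.nat_diff_reindex[symmetric]) (auto intro!: sum.cong simp: Suc_diff_Suc simp del: funpow.simps)
    also have "\<dots> = (\<Sum>k<L. coef f j (n - Suc k) *\<^sub>C (bshift ^^ Suc k) P)"
      using n by (intro sum.mono_neutral_right) (auto simp: bP simp del: funpow.simps)
    also have "norm \<dots> \<le> (\<Sum>k<L. norm (coef f j (n - Suc k) *\<^sub>C (bshift ^^ Suc k) P))"
      by (rule norm_sum)
    also have "\<dots> \<le> (\<Sum>k<L. cmod (coef f j (n - Suc k)) * norm P)"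
      unfolding norm_scaleC by (intro sum_mono mult_left_mono norm_bshift_pow_le) auto
    finally show ?thesis .
  qed
  then show "\<forall>\<^sub>F n in sequentially. norm ((bshift ^^ n) (psum f j n P))
      \<le> (\<Sum>k<L. cmod (coef f j (n - Suc k)) * norm P)"
    by (auto simp: eventually_sequentially)
  have "(\<lambda>n. cmod (coef f j (n - Suc k))) \<longlonglongrightarrow> 0" for k
    by (rule LIMSEQ_offset[of _ "Suc k"]) (simp add: coef_tendsto_0 f)
  then show "(\<lambda>n. \<Sum>k<L. cmod (coef f j (n - Suc k)) * norm P) \<longlonglongrightarrow> 0"
    by (auto intro!: tendsto_null_sum tendsto_mult_left_zero)
qed auto

text \<open>The backward shifts cancel the factor z^n in \<open>recon_pow\<close> and isolate its
  remainder.\<close>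

lemma bshift_pow_eq:
  assumes "f \<in> M"
  shows "(C ^^ n) f = (bshift ^^ n) f - (\<Sum>j\<in>I. (bshift ^^ n) (psum f j n (F j)))"
proof -
  have "(bshift ^^ n) f = (bshift ^^ n) ((\<Sum>j\<in>I. psum f j n (F j)) + (fshift ^^ n) ((C ^^ n) f))"
    using recon_pow[OF assms, of n] by simp
  also have "\<dots> = (\<Sum>j\<in>I. (bshift ^^ n) (psum f j n (F j))) + (C ^^ n) f"
    by (simp add: bshift_pow_add bshift_pow_sum bshift_pow_fshift_pow)
  finally show ?thesis by simp
qed

lemma exists_small_tail:
  assumes "e > 0"
  shows "\<exists>L. (\<Sum>j\<in>I. (norm ((bshift ^^ L) (F j)))\<^sup>2) < e"
proof -
  have "(\<lambda>L. (norm ((bshift ^^ L) (F j)))\<^sup>2) \<longlonglongrightarrow> 0\<^sup>2" for j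
    by (intro tendsto_intros bshift_pow_tendsto_0)
  then have "(\<lambda>L. \<Sum>j\<in>I. (norm ((bshift ^^ L) (F j)))\<^sup>2) \<longlonglongrightarrow> 0"
    by (intro tendsto_null_sum) simp
  from order_tendstoD(2)[OF this assms] show ?thesis
    by (auto simp: eventually_sequentially)
qed

text \<open>
  Each \<open>F j\<close> is split into a polynomial, which \<open>S\<^sup>*\<^sup>n\<close> annihilates up to finitely many small terms, and a
  tail of small norm, which the bound in quadratic mean controls on average. As \<open>\<parallel>C\<^sup>n h\<parallel>\<close> decreases, an estimate on average suffices.
\<close>

lemma C_pow_Cs_pow_tendsto_0:
  assumes q: "q \<in> I" and h: "h = (Cs ^^ p) (v q)"
  shows "(\<lambda>n. norm ((C ^^ n) h)) \<longlonglongrightarrow> 0"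
proof -
  have hM: "h \<in> M" using h q by (simp add: Cs_pow_mem v_mem)
  obtain d where d: "(\<lambda>n. norm ((C ^^ n) h)) \<longlonglongrightarrow> d" and d_le: "\<And>n. d \<le> norm ((C ^^ n) h)"
    using decseq_convergent[OF C_pow_decseq[OF hM], of 0] by auto
  have "d \<ge> 0" by (rule LIMSEQ_le_const[OF d]) auto
  have "d = 0"
  proof (rule ccontr)
    assume "d \<noteq> 0"
    with \<open>d \<ge> 0\<close> have dpos: "d > 0" by simp
    obtain B where B: "B \<ge> 0"
      "\<And>G N. (\<Sum>n<N. \<Sum>j\<in>I. (norm (psum h j n G))\<^sup>2) \<le> B * real N * (norm G)\<^sup>2"
      by (rule cesaro_bound[OF q h]) blast
    \<comment> \<open>The factor 2 comes from (a + b)^2 \<le> 2 a^2 + 2 b^2 and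
      \<open>card I\<close> from Cauchy-Schwarz for the sum over \<open>I\<close>. With
      \<open>e\<close> as below, \<open>c * B * e\<close> is at most a quarter of
      \<open>d\<^sup>2\<close>; the added 1 keeps the denominator positive.\<close>
    define c where "c = 2 * real (card I)"
    define e where "e = d\<^sup>2 / (4 * (c * B + 1))"
    have cB: "c * B \<ge> 0" using B(1) by (simp add: c_def)
    then have "e > 0" using dpos by (simp add: e_def)
    from exists_small_tail[OF this] obtain L
      where L: "(\<Sum>j\<in>I. (norm ((bshift ^^ L) (F j)))\<^sup>2) < e" by blast
    define G where "G j = (fshift ^^ L) ((bshift ^^ L) (F j))" for j
    define P where "P j = F j - G j" for j
    have P: "(bshift ^^ L) (P j) = 0" for j
      by (simp add: P_def G_def bshift_pow_diff bshift_pow_fshift_pow)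
    have F: "F j = P j + G j" for j by (simp add: P_def)
    define a where "a n = norm ((bshift ^^ n) h) + (\<Sum>j\<in>I. norm ((bshift ^^ n) (psum h j n (P j))))" for n
    define X where "X n = (\<Sum>j\<in>I. (norm (psum h j n (G j)))\<^sup>2)" for n
    have "a \<longlonglongrightarrow> 0"
      unfolding a_def
      by (intro tendsto_add_zero tendsto_null_sum bshift_pow_tendsto_0 bshift_pow_psum_tendsto_0[OF hM _ P])
    then have "(\<lambda>n. 2 * (a n)\<^sup>2) \<longlonglongrightarrow> 2 * 0\<^sup>2"
      by (intro tendsto_intros)
    from order_tendstoD(2)[OF this, of "d\<^sup>2 / 4"] dpos obtain N0 where N0: "\<And>n. n \<ge> N0 \<Longrightarrow> 2 * (a n)\<^sup>2 < d\<^sup>2 / 4"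
      by (auto simp: eventually_sequentially)
    have est: "d\<^sup>2 \<le> 2 * (a n)\<^sup>2 + c * X n" for n
    proof -
      let ?b = "\<Sum>j\<in>I. norm (psum h j n (G j))"
      have "(C ^^ n) h = (bshift ^^ n) h - ((\<Sum>j\<in>I. (bshift ^^ n) (psum h j n (P j)))
          + (\<Sum>j\<in>I. (bshift ^^ n) (psum h j n (G j))))"
        unfolding bshift_pow_eq[OF hM] F psum_add bshift_pow_add sum.distrib ..
      then have "norm ((C ^^ n) h) \<le> norm ((bshift ^^ n) h) + norm ((\<Sum>j\<in>I. (bshift ^^ n) (psum h j n (P j)))
          + (\<Sum>j\<in>I. (bshift ^^ n) (psum h j n (G j))))"
        by (simp add: norm_triangle_ineq4)
      also have "\<dots> \<le> norm ((bshift ^^ n) h) + ((\<Sum>j\<in>I. norm ((bshift ^^ n) (psum h j n (P j)))) + ?b)"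
        by (intro add_mono order_refl norm_triangle_mono sum_norm_le norm_bshift_pow_le)
      finally have "norm ((C ^^ n) h) \<le> a n + ?b"
        by (simp add: a_def add.assoc)
      then have "d\<^sup>2 \<le> (a n + ?b)\<^sup>2"
        using d_le[of n] \<open>d \<ge> 0\<close> by (intro power_mono) auto
      also have "\<dots> \<le> 2 * (a n)\<^sup>2 + 2 * ?b\<^sup>2"
        using sum_squares_bound[of "a n" ?b] by (simp add: power2_sum)
      also have "?b\<^sup>2 \<le> X n * real (card I)"
        unfolding X_def by (rule sum_squared_le_sum_of_squares)
      finally show ?thesis by (simp add: c_def mult_ac)
    qed
    \<comment> \<open>From \<open>N0\<close> to \<open>N - 1\<close> there are \<open>N0 + 1\<close>
      indices, at each of which \<open>c * X n\<close> is at least \<open>3 * d\<^sup>2 / 4\<close>.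
      The total exceeds the upper bound \<open>d\<^sup>2 / 4 * real N\<close>, as 3 (N0 + 1) > 2 N0
      + 1.\<close>
    define N where "N = 2 * N0 + 1"
    have "(\<Sum>n<N. X n) = (\<Sum>j\<in>I. \<Sum>n<N. (norm (psum h j n (G j)))\<^sup>2)"
      unfolding X_def by (rule sum.swap)
    also have "\<dots> \<le> (\<Sum>j\<in>I. B * real N * (norm (G j))\<^sup>2)"
    proof (rule sum_mono)
      fix j assume j: "j \<in> I"
      have "(\<Sum>n<N. (norm (psum h j n (G j)))\<^sup>2) \<le> (\<Sum>n<N. \<Sum>i\<in>I. (norm (psum h i n (G j)))\<^sup>2)"
        using j finite_I by (intro sum_mono member_le_sum[where f = "\<lambda>i. (norm (psum h i _ (G j)))\<^sup>2"]) auto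
      also have "\<dots> \<le> B * real N * (norm (G j))\<^sup>2" by (rule B)
      finally show "(\<Sum>n<N. (norm (psum h j n (G j)))\<^sup>2) \<le> B * real N * (norm (G j))\<^sup>2" .
    qed
    also have "\<dots> = B * real N * (\<Sum>j\<in>I. (norm ((bshift ^^ L) (F j)))\<^sup>2)"
      by (simp add: G_def sum_distrib_left)
    also have "\<dots> \<le> B * real N * e"
      using L B(1) by (intro mult_left_mono) auto
    finally have "c * (\<Sum>n<N. X n) \<le> c * (B * real N * e)"
      by (intro mult_left_mono) (simp_all add: c_def)
    also have "\<dots> = (c * B) * e * real N" by simp
    also have "(c * B) * e \<le> d\<^sup>2 / 4"
      using cB dpos by (simp add: e_def field_simps)
    finally have upper: "c * (\<Sum>n<N. X n) \<le> d\<^sup>2 / 4 * real N"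
      by (simp add: mult_right_mono)
    have "(\<Sum>n\<in>{N0..<N}. 3 * d\<^sup>2 / 4) \<le> (\<Sum>n\<in>{N0..<N}. c * X n)"
    proof (rule sum_mono)
      fix n assume "n \<in> {N0..<N}"
      then show "3 * d\<^sup>2 / 4 \<le> c * X n" using est[of n] N0[of n] by simp
    qed
    also have "\<dots> \<le> (\<Sum>n<N. c * X n)"
      by (intro sum_mono2) (auto simp: c_def X_def sum_nonneg)
    finally have "real (N0 + 1) * (3 * d\<^sup>2 / 4) \<le> c * (\<Sum>n<N. X n)"
      by (simp add: N_def sum_distrib_left[symmetric])
    with upper have "real (N0 + 1) * (3 * d\<^sup>2 / 4) \<le> d\<^sup>2 / 4 * real N" by linarith
    then have "d\<^sup>2 * (3 * real (N0 + 1)) \<le> d\<^sup>2 * real N" by (simp add: field_simps)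
    with dpos show False by (simp add: N_def)
  qed
  with d show ?thesis by simp
qed

text \<open>Without coefficients, \<open>f\<close> equals \<open>(fshift ^^ n) ((C ^^ n) f)\<close>
  for every \<open>n\<close> and so vanishes to infinite order at 0.\<close>

lemma eq_0_if_coef_eq_0:
  assumes "f \<in> M" and 0: "\<And>j n. j \<in> I \<Longrightarrow> coef f j n = 0"
  shows "f = 0"
proof (rule hardy_eq_coeffI)
  fix l
  have "f = (fshift ^^ Suc l) ((C ^^ Suc l) f)"
    using recon_pow[OF assms(1), of "Suc l"] by (simp add: psum_def 0)
  then show "hcoeff f l = hcoeff 0 l"
    by (metis hcoeff_fshift_pow_less hcoeff_zero lessI)
qed

text \<open>The vectors of \<open>M\<close> with this property form a subspace \<open>T\<close>,
  closed because all powers of \<open>C\<close> are contractions on \<open>M\<close>. It contains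
  every \<open>(Cs ^^ n) (v j)\<close>, and an element of \<open>M\<close> orthogonal to those has
  only zero coefficients, hence is 0.\<close>

lemma C_pow_tendsto_0:
  assumes f: "f \<in> M"
  shows "(\<lambda>n. norm ((C ^^ n) f)) \<longlonglongrightarrow> 0"
proof -
  define T where "T = {f \<in> M. (\<lambda>n. norm ((C ^^ n) f)) \<longlonglongrightarrow> 0}"
  have subT: "hardy.subspace T"
  proof (rule hardy.subspaceI)
    show "0 \<in> T" using subspace by (simp add: T_def hardy.subspace_0)
  next
    fix x y assume xy: "x \<in> T" "y \<in> T"
    have "(\<lambda>n. norm ((C ^^ n) (x + y))) \<longlonglongrightarrow> 0"
    proof (rule tendsto_0_le[where K = 1])
      show "(\<lambda>n. norm ((C ^^ n) x) + norm ((C ^^ n) y)) \<longlonglongrightarrow> 0"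
        using xy by (auto simp: T_def intro: tendsto_add_zero)
    qed (simp add: C_pow_add norm_triangle_ineq)
    with xy subspace show "x + y \<in> T" by (simp add: T_def hardy.subspace_add)
  next
    fix c x assume x: "x \<in> T"
    then have "(\<lambda>n. norm ((C ^^ n) (c *\<^sub>C x))) \<longlonglongrightarrow> 0"
      by (auto simp: T_def C_pow_scaleC norm_scaleC intro: tendsto_mult_right_zero)
    with x subspace show "c *\<^sub>C x \<in> T" by (simp add: T_def hardy.subspace_scale)
  qed
  have "closed T"
    unfolding closed_sequential_limits
  proof (intro allI impI, elim conjE)
    fix X l assume X: "\<forall>n. X n \<in> T" and l: "X \<longlonglongrightarrow> l"
    have lM: "l \<in> M" using closed_sequentially[OF closed _ l] X by (auto simp: T_def)
    have "(\<lambda>n. norm ((C ^^ n) l)) \<longlonglongrightarrow> 0"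
    proof (rule LIMSEQ_I)
      fix e :: real assume e: "e > 0"
      from LIMSEQ_D[OF l, of "e / 2"] e obtain i where i: "norm (X i - l) < e / 2" by auto
      have "(\<lambda>n. norm ((C ^^ n) (X i))) \<longlonglongrightarrow> 0" using X by (simp add: T_def)
      from LIMSEQ_D[OF this, of "e / 2"] e obtain N
        where N: "\<And>n. n \<ge> N \<Longrightarrow> norm ((C ^^ n) (X i)) < e / 2" by auto
      have "norm ((C ^^ n) l) < e" if "n \<ge> N" for n
      proof -
        have "norm ((C ^^ n) l) = norm ((C ^^ n) (X i) - (C ^^ n) (X i - l))"
          by (simp add: C_pow_diff)
        also have "\<dots> \<le> norm ((C ^^ n) (X i)) + norm ((C ^^ n) (X i - l))"
          by (rule norm_triangle_ineq4)
        also have "norm ((C ^^ n) (X i - l)) \<le> norm (X i - l)"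
          using X lM subspace by (intro norm_C_pow_le hardy.subspace_diff) (auto simp: T_def)
        finally show ?thesis using N[OF that] i by simp
      qed
      then show "\<exists>N. \<forall>n\<ge>N. norm (norm ((C ^^ n) l) - 0) < e" by auto
    qed
    with lM show "l \<in> T" by (simp add: T_def)
  qed
  interpret T: closed_subspace T by unfold_locales (fact subT, fact \<open>closed T\<close>)
  let ?g = "f - hproj T f"
  have gM: "?g \<in> M"
    using f T.hproj_mem[of f] subspace by (intro hardy.subspace_diff) (auto simp: T_def)
  have "coef ?g j n = 0" if "j \<in> I" for j n
  proof -
    have "(Cs ^^ n) (v j) \<in> T"
      using C_pow_Cs_pow_tendsto_0[OF that refl] that by (simp add: T_def Cs_pow_mem v_mem)
    then have "cinner ?g ((Cs ^^ n) (v j)) = 0"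
      by (rule T.hproj_orth)
    then show ?thesis
      unfolding coef_def using gM that by (simp add: C_pow_adj v_mem)
  qed
  from eq_0_if_coef_eq_0[OF gM this] have "f \<in> T"
    using T.hproj_mem[of f] by simp
  then show ?thesis by (simp add: T_def)
qed

section \<open>The coefficient functions of an element\<close>

definition tuple :: "hardy \<Rightarrow> nat \<Rightarrow> hardy" where
  "tuple f j = (if j \<in> I then hardy_of (coef f j) else 0)"

lemma hcoeff_tuple: "f \<in> M \<Longrightarrow> j \<in> I \<Longrightarrow> hcoeff (tuple f j) n = coef f j n"
  by (simp add: tuple_def hcoeff_hardy_of coef_summable)

text \<open>All three compare Taylor coefficients. The last one makes the backward shift on tuples
  correspond to \<open>C\<close> on \<open>M\<close>.\<close>

lemma tuple_add: "f \<in> M \<Longrightarrow> g \<in> M \<Longrightarrow> tuple (f + g) j = tuple f j + tuple g j"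
  and tuple_scaleC: "f \<in> M \<Longrightarrow> tuple (c *\<^sub>C f) j = c *\<^sub>C tuple f j"
  and bshift_tuple: "f \<in> M \<Longrightarrow> bshift (tuple f j) = tuple (C f) j"
proof -
  show "tuple (f + g) j = tuple f j + tuple g j" if "f \<in> M" "g \<in> M"
  proof (cases "j \<in> I")
    case True
    with that subspace show ?thesis
      by (intro hardy_eq_coeffI) (simp add: hcoeff_tuple coef_add hcoeff_add hardy.subspace_add)
  qed (simp add: tuple_def)
  show "tuple (c *\<^sub>C f) j = c *\<^sub>C tuple f j" if "f \<in> M"
  proof (cases "j \<in> I")
    case True
    with that subspace show ?thesis
      by (intro hardy_eq_coeffI) (simp add: hcoeff_tuple coef_scaleC hcoeff_scaleC hardy.subspace_scale)
  qed (simp add: tuple_def)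
  show "bshift (tuple f j) = tuple (C f) j" if "f \<in> M"
  proof (cases "j \<in> I")
    case True
    with that show ?thesis
      using coef_C_pow[of 1 f j] by (intro hardy_eq_coeffI) (simp add: hcoeff_tuple C_mem)
  next
    case False
    then show ?thesis by (intro hardy_eq_coeffI) (simp add: tuple_def)
  qed
qed

text \<open>The limit of \<open>energy_pow\<close>, whose remainder vanishes by
  \<open>C_pow_tendsto_0\<close>.\<close>

lemma norm_tuple:
  assumes f: "f \<in> M"
  shows "(norm f)\<^sup>2 = (\<Sum>j\<in>I. (norm (tuple f j))\<^sup>2)"
proof (rule LIMSEQ_unique)
  have "(\<lambda>n. (norm f)\<^sup>2 - (norm ((C ^^ n) f))\<^sup>2) \<longlonglongrightarrow> (norm f)\<^sup>2 - 0\<^sup>2"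
    by (intro tendsto_intros C_pow_tendsto_0 f)
  moreover have "(norm f)\<^sup>2 - (norm ((C ^^ n) f))\<^sup>2 = (\<Sum>j\<in>I. \<Sum>i<n. (cmod (hcoeff (tuple f j) i))\<^sup>2)" for n
    using energy_pow[OF f, of n] by (subst sum.swap) (simp add: hcoeff_tuple f)
  ultimately show "(\<lambda>n. \<Sum>j\<in>I. \<Sum>i<n. (cmod (hcoeff (tuple f j) i))\<^sup>2) \<longlonglongrightarrow> (norm f)\<^sup>2"
    by simp
  show "(\<lambda>n. \<Sum>j\<in>I. \<Sum>i<n. (cmod (hcoeff (tuple f j) i))\<^sup>2) \<longlonglongrightarrow> (\<Sum>j\<in>I. (norm (tuple f j))\<^sup>2)"
    by (intro tendsto_sum hcoeff_tendsto_norm_sq)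
qed

text \<open>At a point \<open>z\<close> of the disc the remainder in \<open>recon_pow\<close> is
  \<open>z ^ n\<close> times a quantity bounded independently of \<open>n\<close>. Outside the disc
  both sides are 0 by convention.\<close>

lemma hfun_tuple:
  assumes f: "f \<in> M"
  shows "hfun f z = (\<Sum>j\<in>I. hfun (tuple f j) z * hfun (F j) z)"
proof (cases "z \<in> ball 0 1")
  case z: True
  show ?thesis
  proof (rule LIMSEQ_unique)
    have "hfun f z - z ^ n * hfun ((C ^^ n) f) z = (\<Sum>j\<in>I. (\<Sum>i<n. hcoeff (tuple f j) i * z ^ i) * hfun (F j) z)" for n
    proof -
      have "hfun f z = hfun ((\<Sum>j\<in>I. psum f j n (F j)) + (fshift ^^ n) ((C ^^ n) f)) z"
        using recon_pow[OF f, of n] by simp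
      then show ?thesis
        by (simp add: hfun_sum psum_def hfun_fshift_pow hcoeff_tuple f sum_distrib_right mult.assoc)
    qed
    moreover have "(\<lambda>n. z ^ n * hfun ((C ^^ n) f) z) \<longlonglongrightarrow> 0"
    proof (rule tendsto_0_le[where K = "norm f * norm (szego_kernel z)"])
      show "(\<lambda>n. z ^ n) \<longlonglongrightarrow> 0" using z by (intro LIMSEQ_power_zero) simp
      have "cmod (hfun ((C ^^ n) f) z) \<le> norm f * norm (szego_kernel z)" for n
        by (rule order_trans[OF hfun_le_norm[OF z]]) (intro mult_right_mono norm_C_pow_le f norm_ge_zero)
      then show "\<forall>\<^sub>F n in sequentially. norm (z ^ n * hfun ((C ^^ n) f) z) \<le> norm (z ^ n) * (norm f * norm (szego_kernel z))"
        unfolding norm_mult by (intro always_eventually allI mult_left_mono) auto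
    qed
    ultimately show "(\<lambda>n. \<Sum>j\<in>I. (\<Sum>i<n. hcoeff (tuple f j) i * z ^ i) * hfun (F j) z) \<longlonglongrightarrow> hfun f z"
      using tendsto_diff[OF tendsto_const[of "hfun f z"], of "\<lambda>n. z ^ n * hfun ((C ^^ n) f) z" 0] by simp
    show "(\<lambda>n. \<Sum>j\<in>I. (\<Sum>i<n. hcoeff (tuple f j) i * z ^ i) * hfun (F j) z)
        \<longlonglongrightarrow> (\<Sum>j\<in>I. hfun (tuple f j) z * hfun (F j) z)"
      using hfun_sums[OF z] unfolding sums_def by (intro tendsto_sum tendsto_mult_right)
  qed
qed (simp add: hfun_outside)

lemma tuple_diff: "f \<in> M \<Longrightarrow> g \<in> M \<Longrightarrow> tuple (f - g) j = tuple f j - tuple g j"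
  unfolding minus_hardy_def using subspace
  by (simp only: tuple_add tuple_scaleC hardy.subspace_scale)

lemma tuple_dist_tuple:
  assumes "f \<in> M" "g \<in> M"
  shows "tuple_dist I (tuple f) (tuple g) = dist f g"
proof -
  have "f - g \<in> M" using assms subspace by (simp add: hardy.subspace_diff)
  then have "(\<Sum>j\<in>I. (norm (tuple f j - tuple g j))\<^sup>2) = (norm (f - g))\<^sup>2"
    by (simp only: norm_tuple tuple_diff assms)
  then show ?thesis
    by (simp add: tuple_dist_def L2_set_def dist_norm)
qed

text \<open>On \<open>M\<close>, \<open>tuple\<close> is linear, intertwines \<open>C\<close> with
  the backward shift and preserves distances; the image is closed because it is an isometric copy of
  a complete space.\<close>

lemma closed_bshift_invariant_tuple: "closed_bshift_invariant I (tuple ` M)"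
  unfolding closed_bshift_invariant_def
proof (intro conjI)
  show sub: "tuple ` M \<subseteq> hardy_tuples I"
    by (auto simp: hardy_tuples_def tuple_def)
  show "tuple.subspace (tuple ` M)"
  proof (rule tuple.subspaceI)
    have "tuple 0 = 0"
      using tuple_scaleC[of 0 0] subspace by (auto simp: fun_eq_iff hardy.subspace_0)
    then show "0 \<in> tuple ` M"
      using subspace by (metis hardy.subspace_0 image_eqI)
  next
    fix x y assume "x \<in> tuple ` M" "y \<in> tuple ` M"
    then obtain f g where fg: "f \<in> M" "g \<in> M" "x = tuple f" "y = tuple g" by auto
    then have "x + y = tuple (f + g)" by (auto simp: fun_eq_iff tuple_add)
    with fg subspace show "x + y \<in> tuple ` M" by (simp add: hardy.subspace_add)
  next
    fix c x assume "x \<in> tuple ` M"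
    then obtain f where f: "f \<in> M" "x = tuple f" by auto
    then have "(\<lambda>j. c *\<^sub>C x j) = tuple (c *\<^sub>C f)" by (auto simp: fun_eq_iff tuple_scaleC)
    with f subspace show "(\<lambda>j. c *\<^sub>C x j) \<in> tuple ` M" by (simp add: hardy.subspace_scale)
  qed
  show "\<forall>k\<in>tuple ` M. (\<lambda>j. bshift (k j)) \<in> tuple ` M"
  proof
    fix k assume "k \<in> tuple ` M"
    then obtain f where f: "f \<in> M" "k = tuple f" by auto
    then have "(\<lambda>j. bshift (k j)) = tuple (C f)" by (auto simp: fun_eq_iff bshift_tuple)
    with f show "(\<lambda>j. bshift (k j)) \<in> tuple ` M" by (simp add: C_mem)
  qed
  interpret Metric_space "hardy_tuples I" "tuple_dist I"
    by (rule Metric_space_hardy_tuples[OF finite_I])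
  show "closedin (tuple_topology I) (tuple ` M)"
    unfolding tuple_topology_def metric_closedin_iff_sequentially_closed
  proof (intro conjI sub allI impI, elim conjE)
    fix \<sigma> l assume \<sigma>: "range \<sigma> \<subseteq> tuple ` M" and l: "limitin mtopology \<sigma> l sequentially"
    then have "\<forall>n. \<exists>f\<in>M. \<sigma> n = tuple f" by blast
    then obtain X where X: "\<And>n. X n \<in> M" "\<And>n. \<sigma> n = tuple (X n)" by metis
    have "MCauchy \<sigma>" using \<sigma> sub l by (intro convergent_imp_MCauchy) auto
    then have "Cauchy X"
      unfolding MCauchy_def Cauchy_def by (simp add: X tuple_dist_tuple)
    then obtain f where f: "X \<longlonglongrightarrow> f" using Cauchy_convergent_iff convergent_def by blast
    have fM: "f \<in> M" using closed_sequentially[OF closed _ f] X(1) by blast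
    have "limitin mtopology \<sigma> (tuple f) sequentially"
      unfolding limit_metric_sequentially
      using f sub fM X by (auto simp: lim_sequentially tuple_dist_tuple image_subset_iff)
    with l have "l = tuple f"
      by (intro limitin_metric_unique[of \<sigma> l sequentially]) auto
    with fM show "l \<in> tuple ` M" by simp
  qed
qed

end

section \<open>Almost-invariant subspaces\<close>

text \<open>The Szego kernel at 0 is the constant function 1; projecting it onto \<open>M\<close>
  changes no inner product with elements of \<open>M\<close>.\<close>

lemma kernel0_eq:
  assumes "closed_subspace M"
  shows "kernel0 M = hproj M (szego_kernel 0)"
proof -
  interpret closed_subspace M by fact
  show ?thesis
    unfolding kernel0_def
  proof (rule the_equality)
    show "hproj M (szego_kernel 0) \<in> M \<and> (\<forall>f\<in>M. cinner f (hproj M (szego_kernel 0)) = hfun f 0)"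
      by (simp add: cinner_hproj_right cinner_szego_kernel)
  next
    fix \<kappa> assume \<kappa>: "\<kappa> \<in> M \<and> (\<forall>f\<in>M. cinner f \<kappa> = hfun f 0)"
    show "\<kappa> = hproj M (szego_kernel 0)"
    proof (rule hproj_unique[symmetric])
      fix g assume "g \<in> M"
      with \<kappa> have "cinner g (szego_kernel 0 - \<kappa>) = 0"
        by (simp add: cinner_diff_right cinner_szego_kernel)
      then show "cinner (szego_kernel 0 - \<kappa>) g = 0"
        by (simp add: cinner_eq_0_commute[of g])
    qed (use \<kappa> in auto)
  qed
qed

text \<open>A function that does not vanish at 0 forces \<open>kernel0 M\<close> to be nonzero. As
  \<open>f0\<close> takes the value \<open>norm (kernel0 M)\<close> at 0, evaluation at 0 is the
  inner product with \<open>f0\<close> times \<open>hfun f0 0\<close>, a form that also makes sense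
  for \<open>f0 = 0\<close>.\<close>

lemma normalized_kernel0:
  assumes M: "closed_subspace M" and nz: "f \<in> M" "hfun f 0 \<noteq> 0"
  defines "f0 \<equiv> normalized_kernel0 M"
  shows "f0 \<in> M"
    and "norm f0 = 1"
    and "g \<in> M \<Longrightarrow> hfun g 0 = cinner g f0 * hfun f0 0"
proof -
  interpret closed_subspace M by fact
  let ?k = "kernel0 M"
  have k: "?k \<in> M" "\<And>g. g \<in> M \<Longrightarrow> cinner g ?k = hfun g 0"
    by (simp_all add: kernel0_eq[OF M] cinner_hproj_right cinner_szego_kernel)
  have k0: "norm ?k \<noteq> 0" using k(2)[OF nz(1)] nz(2) by auto
  have f0: "f0 = of_real (inverse (norm ?k)) *\<^sub>C ?k"
    by (simp add: f0_def normalized_kernel0_def scaleR_hardy_def)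
  show "f0 \<in> M" unfolding f0 using k(1) subspace by (rule hardy.subspace_scale[rotated])
  show "norm f0 = 1" using k0 by (simp add: f0_def normalized_kernel0_def)
  have "hfun ?k 0 = of_real (norm ?k) * of_real (norm ?k)"
    using k(2)[OF k(1)] by (simp add: cinner_self_norm power2_eq_square)
  then have "hfun f0 0 = of_real (norm ?k)"
    using k0 by (simp add: f0)
  then show "hfun g 0 = cinner g f0 * hfun f0 0" if "g \<in> M"
    using k(2)[OF that] k0 by (simp add: f0 cinner_scaleC_right del: hfun_scaleC)
qed

section \<open>Orthonormal bases of finite-dimensional subspaces\<close>

lemma orthonormal_expansion:
  assumes on: "\<And>i j. i \<in> A \<Longrightarrow> j \<in> A \<Longrightarrow> cinner (e i) (e j) = (if i = j then 1 else 0)"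
    and A: "finite A" and w: "w \<in> hardy.span (e ` A)"
  shows "w = (\<Sum>j\<in>A. cinner w (e j) *\<^sub>C e j)"
  using w
proof (induction rule: hardy.span_induct_alt)
  case (step c x y)
  then obtain i where i: "i \<in> A" "x = e i" by auto
  have "(\<Sum>j\<in>A. cinner (c *\<^sub>C x + y) (e j) *\<^sub>C e j)
      = c *\<^sub>C (\<Sum>j\<in>A. cinner x (e j) *\<^sub>C e j) + (\<Sum>j\<in>A. cinner y (e j) *\<^sub>C e j)"
    by (simp add: cinner_add_left cinner_scaleC_left hardy.scale_left_distrib sum.distrib hardy.scale_sum_right)
  also have "(\<Sum>j\<in>A. cinner x (e j) *\<^sub>C e j) = (\<Sum>j\<in>A. if j = i then e j else 0)"
    using i on by (intro sum.cong) auto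
  also have "\<dots> = x" using i A by simp
  finally show ?case using step.IH by simp
qed simp

lemma norm_orthonormal_sum:
  assumes on: "\<And>i j. i \<in> A \<Longrightarrow> j \<in> A \<Longrightarrow> cinner (e i) (e j) = (if i = j then 1 else 0)"
    and A: "finite A"
  shows "(norm (\<Sum>j\<in>A. c j *\<^sub>C e j))\<^sup>2 = (\<Sum>j\<in>A. (cmod (c j))\<^sup>2)"
proof -
  let ?w = "\<Sum>j\<in>A. c j *\<^sub>C e j"
  have "cinner ?w ?w = (\<Sum>i\<in>A. \<Sum>j\<in>A. c j * cnj (c i) * cinner (e j) (e i))"
    by (simp add: cinner_sum_left cinner_sum_right cinner_scaleC_left cinner_scaleC_right
        sum_distrib_left mult_ac)
  also have "\<dots> = (\<Sum>i\<in>A. \<Sum>j\<in>A. if j = i then c j * cnj (c i) else 0)"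
    by (intro sum.cong refl) (simp add: on)
  also have "\<dots> = of_real (\<Sum>j\<in>A. (cmod (c j))\<^sup>2)"
    using A by (simp add: complex_norm_square del: of_real_power)
  finally show ?thesis
    unfolding cinner_self_norm of_real_eq_iff .
qed

text \<open>Induction on the set: the normalised part of \<open>b\<close> orthogonal to the span of
  \<open>B\<close> is added at the index \<open>Suc (card B)\<close>, so that the indices fill an
  interval starting at 1.\<close>

lemma gram_schmidt:
  "finite B \<Longrightarrow> hardy.independent B \<Longrightarrow> \<exists>e. orthonormal_basis e (card B) (hardy.span B)"
proof (induction B rule: finite_induct)
  case empty
  then show ?case by (simp add: orthonormal_basis_def)
next
  case (insert b B)
  have b: "b \<notin> hardy.span B" and "hardy.independent B"
    using insert.prems insert.hyps by (simp_all add: hardy.independent_insert split: if_splits)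
  with insert.IH obtain e where e: "orthonormal_basis e (card B) (hardy.span B)" by blast
  let ?n = "card B"
  have on: "cinner (e i) (e j) = (if i = j then 1 else 0)" if "i \<in> {1..?n}" "j \<in> {1..?n}" for i j
    using e that by (simp add: orthonormal_basis_def)
  have sp: "hardy.span (e ` {1..?n}) = hardy.span B"
    using e by (simp add: orthonormal_basis_def)
  define p where "p = (\<Sum>j=1..?n. cinner b (e j) *\<^sub>C e j)"
  define u where "u = b - p"
  have pB: "p \<in> hardy.span B"
    unfolding p_def sp[symmetric]
    by (intro hardy.span_sum hardy.span_scale hardy.span_base) auto
  have u0: "norm u \<noteq> 0" using b pB by (auto simp: u_def)
  have ue: "cinner u (e i) = 0" if i: "i \<in> {1..?n}" for i
  proof -
    have "cinner p (e i) = (\<Sum>j=1..?n. if j = i then cinner b (e j) else 0)"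
      unfolding p_def cinner_sum_left cinner_scaleC_left
      using i by (intro sum.cong refl) (simp add: on)
    then show ?thesis using i by (simp add: u_def cinner_diff_left)
  qed
  define x where "x = of_real (inverse (norm u)) *\<^sub>C u"
  have "cinner u u = of_real (norm u) * of_real (norm u)"
    by (simp add: cinner_self_norm power2_eq_square)
  then have xx: "cinner x x = 1"
    using u0 by (simp add: x_def cinner_scaleC_left cinner_scaleC_right field_simps)
  have xe: "cinner x (e i) = 0" "cinner (e i) x = 0" if "i \<in> {1..?n}" for i
    using ue[OF that] cinner_eq_0_commute[of u "e i"]
    by (simp_all add: x_def cinner_scaleC_left cinner_scaleC_right)
  define e' where "e' = e(Suc ?n := x)"
  have img: "e' ` {1..Suc ?n} = insert x (e ` {1..?n})"
    by (auto simp: e'_def atLeastAtMostSuc_conv image_def)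
  have on': "cinner (e' i) (e' j) = (if i = j then 1 else 0)"
    if "i \<in> {1..Suc ?n}" "j \<in> {1..Suc ?n}" for i j
    using that on xx xe by (cases "i = Suc ?n"; cases "j = Suc ?n") (auto simp: e'_def)
  have "hardy.span (insert x (e ` {1..?n})) = hardy.span (insert b B)"
    unfolding hardy.span_eq
  proof (intro conjI insert_subsetI)
    have mono: "hardy.span B \<subseteq> hardy.span (insert b B)" by (intro hardy.span_mono) auto
    show "x \<in> hardy.span (insert b B)"
      unfolding x_def u_def using pB mono
      by (intro hardy.span_scale hardy.span_diff) (auto intro: hardy.span_base)
    show "e ` {1..?n} \<subseteq> hardy.span (insert b B)"
      using hardy.span_superset[of "e ` {1..?n}"] mono unfolding sp by blast
    have mono': "hardy.span B \<subseteq> hardy.span (insert x (e ` {1..?n}))"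
      unfolding sp[symmetric] by (intro hardy.span_mono) auto
    then show "B \<subseteq> hardy.span (insert x (e ` {1..?n}))"
      using hardy.span_superset[of B] by blast
    have "b = of_real (norm u) *\<^sub>C x + p"
      using u0 by (simp add: x_def u_def)
    also have "\<dots> \<in> hardy.span (insert x (e ` {1..?n}))"
      using pB mono' by (intro hardy.span_add hardy.span_scale) (auto intro: hardy.span_base)
    finally show "b \<in> hardy.span (insert x (e ` {1..?n}))" .
  qed
  then have "orthonormal_basis e' (card (insert b B)) (hardy.span (insert b B))"
    using insert.hyps on' img by (simp add: orthonormal_basis_def del: image_insert)
  then show ?case by (intro exI[of _ e'])
qed

text \<open>Turns a direct sum into an orthogonal one. The new space is the image of
  \<open>F\<close> under \<open>Q\<close>, the identity minus the projection onto \<open>M\<close>: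
  \<open>Q\<close> is injective on \<open>F\<close> because its kernel is \<open>M\<close>, and it
  alters vectors only by elements of \<open>M\<close>.\<close>

lemma orthogonal_complement_choice:
  assumes M: "closed_subspace M" and dim: "has_cdim F m" and disj: "M \<inter> F = {0}"
  obtains F' where "hardy.subspace F'" "has_cdim F' m" "orthogonal_sets M F'" "M + F' = M + F"
proof -
  interpret closed_subspace M by fact
  define Q where "Q f = f - hproj M f" for f
  interpret Q: module_hom scaleC scaleC Q
    by unfold_locales
      (simp_all add: Q_def hproj_add hproj_scaleC algebra_simps)
  obtain B where B: "finite B" "card B = m" "hardy.independent B" "hardy.span B = F"
    using dim by (auto simp: has_cdim_def)
  have inj: "inj_on Q (hardy.span B)"
  proof (rule inj_onI)
    fix x y assume xy: "x \<in> hardy.span B" "y \<in> hardy.span B" "Q x = Q y"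
    then have "x - y = hproj M x - hproj M y" by (simp add: Q_def algebra_simps)
    also have "\<dots> \<in> M" using subspace by (intro hardy.subspace_diff) auto
    finally have "x - y \<in> M \<inter> F" using xy B(4) by (auto intro: hardy.span_diff)
    with disj show "x = y" by simp
  qed
  show ?thesis
  proof
    show "hardy.subspace (Q ` F)"
      unfolding B(4)[symmetric] Q.span_image[symmetric] by (rule hardy.subspace_span)
    show "has_cdim (Q ` F) m"
      unfolding has_cdim_def
    proof (intro exI conjI)
      show "hardy.independent (Q ` B)" using B(3) inj by (rule Q.independent_injective_image)
      have "inj_on Q B" using inj hardy.span_superset by (rule inj_on_subset)
      then show "card (Q ` B) = m" using B(2) by (simp add: card_image)
      show "hardy.span (Q ` B) = Q ` F" by (simp add: Q.span_image B(4))
    qed (use B in simp)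
    show "orthogonal_sets M (Q ` F)"
      unfolding orthogonal_sets_def using hproj_orth cinner_eq_0_commute by (auto simp: Q_def)
    have 1: "a + Q w \<in> M + F" if "a \<in> M" "w \<in> F" for a w
    proof -
      have "a + Q w = (a - hproj M w) + w" by (simp add: Q_def)
      then show ?thesis using that subspace by (metis hardy.subspace_diff hproj_mem set_plus_intro)
    qed
    have 2: "a + w \<in> M + Q ` F" if "a \<in> M" "w \<in> F" for a w
    proof -
      have "a + w = (a + hproj M w) + Q w" by (simp add: Q_def)
      then show ?thesis using that subspace by (metis hardy.subspace_add hproj_mem set_plus_intro imageI)
    qed
    show "M + Q ` F = M + F"
      using 1 2 by (auto elim!: set_plus_elim)
  qed
qed

text \<open>The choice \<open>f0 = 0\<close>, \<open>I = {1..m}\<close> stands for the case that all functions in \<open>M\<close> vanish at \<open>0\<close>.\<close>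

locale almost_invariant = closed_subspace +
  fixes f0 :: hardy and e :: "nat \<Rightarrow> hardy" and m :: nat and I :: "nat set"
  assumes f0_mem: "f0 \<in> M"
    and eval_f0: "f \<in> M \<Longrightarrow> hfun f 0 = cinner f f0 * hfun f0 0"
    and I_cases: "norm f0 = 1 \<and> I = {0..m} \<or> f0 = 0 \<and> I = {1..m}"
    and orthonormal: "i \<in> {1..m} \<Longrightarrow> j \<in> {1..m} \<Longrightarrow> cinner (e i) (e j) = (if i = j then 1 else 0)"
    and orthogonal: "f \<in> M \<Longrightarrow> j \<in> {1..m} \<Longrightarrow> cinner f (e j) = 0"
    and bshift_mem: "f \<in> M \<Longrightarrow> bshift f \<in> M + hardy.span (e ` {1..m})"
begin

text \<open>The part of \<open>f\<close> orthogonal to \<open>f0\<close>. For \<open>f\<close> in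
  \<open>M\<close> it vanishes at 0 by \<open>eval_f0\<close>, so it can be divided by z without
  loss of norm.\<close>

definition rem0 :: "hardy \<Rightarrow> hardy" where
  "rem0 f = f - cinner f f0 *\<^sub>C f0"

definition compr :: "hardy \<Rightarrow> hardy" where
  "compr f = hproj M (bshift (rem0 f))"

definition compr_adj :: "hardy \<Rightarrow> hardy" where
  "compr_adj f = rem0 (hproj M (fshift f))"

text \<open>Chosen so that, for \<open>f\<close> in \<open>M\<close>,
  \<open>cinner f (vec j)\<close> is the coordinate of \<open>f\<close> along \<open>f0\<close> if
  \<open>j = 0\<close>, and of \<open>bshift (rem0 f)\<close> along \<open>e j\<close> if
  \<open>j\<close> is in \<open>{1..m}\<close>.\<close>

definition vec :: "nat \<Rightarrow> hardy" where
  "vec j = (if j = 0 then f0 else rem0 (hproj M (fshift (e j))))"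

text \<open>The functions that the coefficient functions multiply in the representation.\<close>

definition gen :: "nat \<Rightarrow> hardy" where
  "gen j = (if j = 0 then f0 else fshift (e j))"

text \<open>Treats both cases of \<open>I_cases\<close> at once: if \<open>f0 = 0\<close>, the index
  0 is missing from \<open>I\<close> and its term is 0.\<close>

lemma sum_I:
  fixes g :: "nat \<Rightarrow> 'a::comm_monoid_add"
  assumes "f0 = 0 \<Longrightarrow> g 0 = 0"
  shows "(\<Sum>j\<in>I. g j) = g 0 + (\<Sum>j=1..m. g j)"
  using I_cases
proof
  assume "norm f0 = 1 \<and> I = {0..m}"
  then show ?thesis by (simp add: sum.atLeast_Suc_atMost)
next
  assume "f0 = 0 \<and> I = {1..m}"
  then show ?thesis using assms by simp
qed

lemma rem0_mem: "f \<in> M \<Longrightarrow> rem0 f \<in> M"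
  unfolding rem0_def using subspace f0_mem by (intro hardy.subspace_diff hardy.subspace_scale)

lemma cinner_rem0: "cinner (rem0 f) g = cinner f (rem0 g)"
  by (simp add: rem0_def cinner_diff_left cinner_diff_right cinner_scaleC_left cinner_scaleC_right
      cinner_commute[of f0 g])

lemma norm_rem0: "(norm f)\<^sup>2 = (cmod (cinner f f0))\<^sup>2 + (norm (rem0 f))\<^sup>2"
proof (cases "f0 = 0")
  case False
  then have 1: "norm f0 = 1" using I_cases by auto
  then have "cinner f0 f0 = 1" by (simp add: cinner_self_norm)
  then have "cinner (cinner f f0 *\<^sub>C f0) (rem0 f) = 0"
    by (simp add: rem0_def cinner_diff_right cinner_scaleC_left cinner_scaleC_right
        cinner_commute[of f0 f])
  from pythagoras_hardy[OF this] show ?thesis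
    by (simp add: rem0_def norm_scaleC 1)
next
  case True
  then have "rem0 f = f" unfolding rem0_def by simp
  with True show ?thesis by simp
qed

text \<open>\<open>rem0 f\<close> is in \<open>M\<close>, so its backward shift is in
  \<open>M\<close> plus the span of the \<open>e j\<close>. As these are orthogonal, the two parts
  are the projection \<open>compr f\<close> and an orthonormal expansion, whose coefficients are
  moved onto \<open>f\<close> by adjointness.\<close>

lemma bshift_rem0:
  assumes f: "f \<in> M"
  shows "bshift (rem0 f) = compr f + (\<Sum>j=1..m. cinner f (vec j) *\<^sub>C e j)"
proof -
  from bshift_mem[OF rem0_mem[OF f]] obtain g w
    where gw: "g \<in> M" "w \<in> hardy.span (e ` {1..m})" "bshift (rem0 f) = g + w"
    by (auto elim: set_plus_elim)
  have w: "w = (\<Sum>j=1..m. cinner w (e j) *\<^sub>C e j)"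
    using orthonormal_expansion[OF orthonormal _ gw(2)] by simp
  have "cinner a w = 0" if "a \<in> M" for a
    by (subst w) (simp add: cinner_sum_right cinner_scaleC_right orthogonal that)
  then have "cinner w a = 0" if "a \<in> M" for a
    using that by (simp add: cinner_eq_0_commute[of w])
  then have "compr f = g"
    unfolding compr_def by (intro hproj_unique gw) (simp add: gw)
  moreover have "cinner w (e j) = cinner f (vec j)" if "j \<in> {1..m}" for j
  proof -
    have "cinner w (e j) = cinner (bshift (rem0 f)) (e j)"
      using orthogonal[OF gw(1) that] by (simp add: gw(3) cinner_add_left)
    also have "\<dots> = cinner (rem0 f) (hproj M (fshift (e j)))"
      by (simp add: cinner_bshift cinner_hproj_right rem0_mem f)
    finally show ?thesis using that by (simp add: cinner_rem0 vec_def)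
  qed
  then have "(\<Sum>j=1..m. cinner w (e j) *\<^sub>C e j) = (\<Sum>j=1..m. cinner f (vec j) *\<^sub>C e j)"
    by (intro sum.cong) auto
  ultimately show ?thesis using gw(3) w by simp
qed

text \<open>Because \<open>rem0 f\<close> vanishes at 0, shifting it back and then forth returns it,
  and the backward shift preserves its norm. Pythagoras for \<open>bshift_rem0\<close> then gives
  the energy identity, and applying the shift to it gives the reconstruction.\<close>

sublocale shift_model M compr compr_adj I vec gen
proof
  show "finite I" using I_cases by auto
  show "compr f \<in> M" if "f \<in> M" for f by (simp add: compr_def)
  show "compr_adj f \<in> M" if "f \<in> M" for f by (simp add: compr_adj_def rem0_mem)
  show "vec j \<in> M" for j by (simp add: vec_def f0_mem rem0_mem)
  show "compr (f + g) = compr f + compr g" for f g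
  proof -
    have "rem0 (f + g) = rem0 f + rem0 g"
      by (simp add: rem0_def cinner_add_left hardy.scale_left_distrib)
    then show ?thesis by (simp add: compr_def bshift_add hproj_add)
  qed
  show "compr (c *\<^sub>C f) = c *\<^sub>C compr f" for c f
  proof -
    have "rem0 (c *\<^sub>C f) = c *\<^sub>C rem0 f"
      by (simp add: rem0_def cinner_scaleC_left hardy.scale_right_diff_distrib)
    then show ?thesis by (simp add: compr_def bshift_scaleC hproj_scaleC)
  qed
  show "cinner (compr f) g = cinner f (compr_adj g)" if "f \<in> M" "g \<in> M" for f g
    using that by (simp add: compr_def compr_adj_def cinner_hproj cinner_bshift cinner_rem0[symmetric]
        cinner_hproj_right rem0_mem)
  fix f assume f: "f \<in> M"
  let ?w = "\<Sum>j=1..m. cinner f (vec j) *\<^sub>C e j"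
  have "hfun (rem0 f) 0 = 0" by (simp add: rem0_def eval_f0[OF f])
  then have S: "fshift (bshift (rem0 f)) = rem0 f" by (rule fshift_bshift)
  have "cinner (compr f) ?w = 0"
    by (simp add: cinner_sum_right cinner_scaleC_right orthogonal compr_def)
  from pythagoras_hardy[OF this]
  have "(norm (bshift (rem0 f)))\<^sup>2 = (norm (compr f))\<^sup>2 + (norm ?w)\<^sup>2"
    unfolding bshift_rem0[OF f] .
  moreover have "(norm ?w)\<^sup>2 = (\<Sum>j=1..m. (cmod (cinner f (vec j)))\<^sup>2)"
    by (rule norm_orthonormal_sum[OF orthonormal]) simp_all
  moreover have "norm (bshift (rem0 f)) = norm (rem0 f)"
    using S by (metis norm_fshift)
  moreover have vec_0: "vec 0 = f0" by (simp add: vec_def)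
  moreover have "(\<Sum>j\<in>I. (cmod (cinner f (vec j)))\<^sup>2)
      = (cmod (cinner f (vec 0)))\<^sup>2 + (\<Sum>j=1..m. (cmod (cinner f (vec j)))\<^sup>2)"
    by (rule sum_I) (unfold vec_0, simp)
  ultimately show "(norm f)\<^sup>2 = (norm (compr f))\<^sup>2 + (\<Sum>j\<in>I. (cmod (cinner f (vec j)))\<^sup>2)"
    by (simp add: norm_rem0[of f])
  have "f = cinner f f0 *\<^sub>C f0 + fshift (bshift (rem0 f))"
    unfolding S by (simp add: rem0_def)
  also have "fshift (bshift (rem0 f)) = fshift (compr f) + (\<Sum>j=1..m. cinner f (vec j) *\<^sub>C fshift (e j))"
    by (simp add: bshift_rem0[OF f] fshift_add fshift_sum fshift_scaleC)
  also have "(\<Sum>j=1..m. cinner f (vec j) *\<^sub>C fshift (e j)) = (\<Sum>j=1..m. cinner f (vec j) *\<^sub>C gen j)"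
    by (intro sum.cong) (auto simp: gen_def)
  moreover have "(\<Sum>j\<in>I. cinner f (vec j) *\<^sub>C gen j)
      = cinner f (vec 0) *\<^sub>C gen 0 + (\<Sum>j=1..m. cinner f (vec j) *\<^sub>C gen j)"
    by (rule sum_I) (unfold vec_0, simp)
  ultimately show "f = (\<Sum>j\<in>I. cinner f (vec j) *\<^sub>C gen j) + fshift (compr f)"
    by (simp add: vec_0 gen_def add_ac)
qed

lemma hfun_tuple_eq:
  assumes "f \<in> M"
  shows "hfun f z = hfun (tuple f 0) z * hfun f0 z + z * (\<Sum>j=1..m. hfun (tuple f j) z * hfun (e j) z)"
proof -
  have "(\<Sum>j\<in>I. hfun (tuple f j) z * hfun (gen j) z)
      = hfun (tuple f 0) z * hfun (gen 0) z + (\<Sum>j=1..m. hfun (tuple f j) z * hfun (gen j) z)"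
    by (rule sum_I) (unfold gen_def, simp)
  then show ?thesis
    unfolding hfun_tuple[OF assms, of z] by (simp add: gen_def sum_distrib_left mult_ac)
qed

lemma hfun_image_eq:
  "hfun ` M = {f. \<exists>k\<in>tuple ` M. \<forall>z. f z = hfun (k 0) z * hfun f0 z
      + z * (\<Sum>j=1..m. hfun (k j) z * hfun (e j) z)}"
  by (auto simp: hfun_tuple_eq fun_eq_iff image_iff simp del: One_nat_def)

text \<open>The formula determines \<open>f\<close>, so \<open>f\<close> is the element of
  \<open>M\<close> from which \<open>k\<close> arises, and \<open>norm_tuple\<close>
  applies.\<close>

lemma norm_of_representation:
  assumes "k \<in> tuple ` M"
    and "\<And>z. hfun f z = hfun (k 0) z * hfun f0 z + z * (\<Sum>j=1..m. hfun (k j) z * hfun (e j) z)"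
  shows "(norm f)\<^sup>2 = (\<Sum>j\<in>I. (norm (k j))\<^sup>2)"
proof -
  from assms(1) obtain g where g: "g \<in> M" "k = tuple g" by blast
  have "f = g"
    by (rule hardy_eqI) (simp only: assms(2) hfun_tuple_eq[OF g(1)] g(2))
  with g show ?thesis by (simp add: norm_tuple)
qed

end

section \<open>From a representation back to almost-invariance\<close>

lemma hfun_bshift: "z \<in> ball 0 1 \<Longrightarrow> z * hfun (bshift f) z = hfun f z - hfun f 0"
  by (simp add: bshift.rep_eq)

text \<open>Every coefficient function is split as k(z) = k(0) + z (bshift k)(z): the parts with the
  factor z give \<open>g\<close>, the constants give multiples of \<open>bshift f0\<close> and of
  the \<open>e j\<close>.\<close>

lemma bshift_representation:
  assumes f: "\<And>z. hfun f z = hfun k0 z * hfun f0 z + z * (\<Sum>j\<in>A. hfun (k j) z * hfun (e j) z)"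
    and g: "\<And>z. hfun g z = hfun (bshift k0) z * hfun f0 z + z * (\<Sum>j\<in>A. hfun (bshift (k j)) z * hfun (e j) z)"
  shows "bshift f = g + hfun k0 0 *\<^sub>C bshift f0 + (\<Sum>j\<in>A. hfun (k j) 0 *\<^sub>C e j)"
    (is "_ = ?h")
proof -
  \<comment> \<open>The two sides are compared after multiplication by z, which is injective and
    avoids the removable singularity at 0.\<close>
  have "fshift (bshift f) = fshift ?h"
  proof (rule hardy_eqI)
    fix z :: complex assume z: "z \<in> ball 0 1"
    have dec: "hfun u z = hfun u 0 + z * hfun (bshift u) z" for u
      using hfun_bshift[OF z, of u] by simp
    have "z * hfun (bshift f) z = hfun k0 z * hfun f0 z - hfun k0 0 * hfun f0 0
        + z * (\<Sum>j\<in>A. hfun (k j) z * hfun (e j) z)"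
      using hfun_bshift[OF z, of f] f[of z] f[of 0] by simp
    also have "(\<Sum>j\<in>A. hfun (k j) z * hfun (e j) z)
        = (\<Sum>j\<in>A. hfun (k j) 0 * hfun (e j) z) + z * (\<Sum>j\<in>A. hfun (bshift (k j)) z * hfun (e j) z)"
      unfolding sum_distrib_left sum.distrib[symmetric]
      by (intro sum.cong refl) (subst dec, simp add: algebra_simps)
    also have "hfun k0 z * hfun f0 z - hfun k0 0 * hfun f0 0
        = z * hfun (bshift k0) z * hfun f0 z + hfun k0 0 * (z * hfun (bshift f0) z)"
      unfolding hfun_bshift[OF z, of f0] by (subst dec[of k0]) (simp add: algebra_simps)
    finally show "hfun (fshift (bshift f)) z = hfun (fshift ?h) z"
      by (simp add: g[of z] hfun_sum algebra_simps)
  qed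
  then show ?thesis by (metis bshift_fshift)
qed

lemma bshift_zero [simp]: "bshift 0 = 0"
  by (rule hardy_eq_coeffI) simp

text \<open>Invariance of \<open>K\<close> puts the function \<open>g\<close> of
  \<open>bshift_representation\<close> into \<open>M\<close>; the other terms lie in
  \<open>M + F\<close> by the assumptions on \<open>f0\<close> and the \<open>e j\<close>. Taking
  \<open>f0 = 0\<close> covers the case that all functions in \<open>M\<close> vanish at 0.\<close>

lemma almost_invariant_bshift_if_representation:
  assumes M: "hardy.subspace M" "closed M"
    and F: "hardy.subspace F" "has_cdim F m" "orthogonal_sets M F" "\<And>j. j \<in> {1..m} \<Longrightarrow> e j \<in> F"
    and inv: "\<And>k. k \<in> K \<Longrightarrow> (\<lambda>j. bshift (k j)) \<in> K"
    and rep: "hfun ` M = {f. \<exists>k\<in>K. \<forall>z. f z = hfun (k 0) z * hfun f0 z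
        + z * (\<Sum>j=1..m. hfun (k j) z * hfun (e j) z)}"
    and f0: "bshift f0 \<in> M + F"
  shows "almost_invariant_bshift M m"
  unfolding almost_invariant_bshift_def
proof (intro conjI exI)
  show "M \<inter> F = {0}"
  proof
    have "x = 0" if "x \<in> M" "x \<in> F" for x
      using F(3) that cinner_self_norm[of x] by (auto simp: orthogonal_sets_def)
    then show "M \<inter> F \<subseteq> {0}" by auto
  qed (use M F in \<open>simp add: hardy.subspace_0\<close>)
  show "bshift ` M \<subseteq> M + F"
  proof
    fix u assume "u \<in> bshift ` M"
    then obtain f where f: "f \<in> M" "u = bshift f" by blast
    then have "hfun f \<in> hfun ` M" by blast
    then obtain k where k: "k \<in> K" "\<And>z. hfun f z = hfun (k 0) z * hfun f0 z
        + z * (\<Sum>j=1..m. hfun (k j) z * hfun (e j) z)"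
      unfolding rep by blast
    have "(\<lambda>z. hfun (bshift (k 0)) z * hfun f0 z + z * (\<Sum>j=1..m. hfun (bshift (k j)) z * hfun (e j) z)) \<in> hfun ` M"
      unfolding rep by (intro CollectI bexI[OF _ inv[OF k(1)]]) simp
    then obtain g where g: "g \<in> M" "(\<lambda>z. hfun (bshift (k 0)) z * hfun f0 z
        + z * (\<Sum>j=1..m. hfun (bshift (k j)) z * hfun (e j) z)) = hfun g"
      by (rule imageE)
    from f0 obtain a w where aw: "a \<in> M" "w \<in> F" "bshift f0 = a + w" by (auto elim: set_plus_elim)
    let ?c = "hfun (k 0) 0"
    have "u = (g + ?c *\<^sub>C a) + (?c *\<^sub>C w + (\<Sum>j=1..m. hfun (k j) 0 *\<^sub>C e j))"
      unfolding f(2) bshift_representation[OF k(2) fun_cong[OF g(2), symmetric]] aw(3)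
      by (simp add: hardy.scale_right_distrib add_ac)
    moreover have "g + ?c *\<^sub>C a \<in> M"
      using M g aw by (intro hardy.subspace_add hardy.subspace_scale)
    moreover have "?c *\<^sub>C w + (\<Sum>j=1..m. hfun (k j) 0 *\<^sub>C e j) \<in> F"
      using F aw by (intro hardy.subspace_add hardy.subspace_scale hardy.subspace_sum)
    ultimately show "u \<in> M + F" by (metis set_plus_intro)
  qed
qed (use M F in auto)

theorem corollary3p4:
  fixes m :: nat and M :: "hardy set"
  assumes "hardy.subspace M" and "closed M"
  shows "almost_invariant_bshift M m \<longleftrightarrow>
    (\<exists>F e. hardy.subspace F \<and> has_cdim F m \<and> orthogonal_sets M F \<and> orthonormal_basis e m F \<and>
      (((\<exists>f\<in>M. hfun f 0 \<noteq> 0) \<and>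
        (\<exists>K. closed_bshift_invariant {0..m} K \<and>
          hfun ` M = {f. \<exists>k\<in>K. \<forall>z. f z = hfun (k 0) z * hfun (normalized_kernel0 M) z
                                      + z * (\<Sum>j=1..m. hfun (k j) z * hfun (e j) z)} \<and>
          (\<forall>f. \<forall>k\<in>K. (\<forall>z. hfun f z = hfun (k 0) z * hfun (normalized_kernel0 M) z
                                      + z * (\<Sum>j=1..m. hfun (k j) z * hfun (e j) z)) \<longrightarrow>
             (norm f)\<^sup>2 = (\<Sum>j=0..m. (norm (k j))\<^sup>2))) \<and>
        bshift (normalized_kernel0 M) \<in> M + F)
       \<or>
       ((\<forall>f\<in>M. hfun f 0 = 0) \<and>
        (\<exists>K. closed_bshift_invariant {1..m} K \<and>
          hfun ` M = {f. \<exists>k\<in>K. \<forall>z. f z = z * (\<Sum>j=1..m. hfun (k j) z * hfun (e j) z)} \<and>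
          (\<forall>f. \<forall>k\<in>K. (\<forall>z. hfun f z = z * (\<Sum>j=1..m. hfun (k j) z * hfun (e j) z)) \<longrightarrow>
             (norm f)\<^sup>2 = (\<Sum>j=1..m. (norm (k j))\<^sup>2))))))"
proof (standard, goal_cases)
  case 1
  interpret M: closed_subspace M by unfold_locales (fact assms)+
  let ?f0 = "normalized_kernel0 M"
  from 1 obtain F0 where F0: "has_cdim F0 m" "M \<inter> F0 = {0}" "bshift ` M \<subseteq> M + F0"
    by (auto simp: almost_invariant_bshift_def)
  \<comment> \<open>Almost-invariance yields a direct sum with \<open>F0\<close>; the theorem asks
    for an orthogonal one, and \<open>M + F0\<close> stays the same.\<close>
  from orthogonal_complement_choice[OF M.closed_subspace_axioms F0(1,2)] obtain F
    where F: "hardy.subspace F" "has_cdim F m" "orthogonal_sets M F" "M + F = M + F0" by blast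
  from F(2) obtain B where "finite B" "card B = m" "hardy.independent B" "hardy.span B = F"
    by (auto simp: has_cdim_def)
  with gram_schmidt[of B] obtain e where e: "orthonormal_basis e m F" by auto
  then have span: "hardy.span (e ` {1..m}) = F" by (simp add: orthonormal_basis_def)
  have eF: "e j \<in> F" if "j \<in> {1..m}" for j
    using that unfolding span[symmetric] by (intro hardy.span_base) auto
  have on: "cinner (e i) (e j) = (if i = j then 1 else 0)" if "i \<in> {1..m}" "j \<in> {1..m}" for i j
    using e that by (simp add: orthonormal_basis_def)
  have orth: "cinner f (e j) = 0" if "f \<in> M" "j \<in> {1..m}" for f j
    using F(3) eF that by (simp add: orthogonal_sets_def)
  have shift: "bshift f \<in> M + hardy.span (e ` {1..m})" if "f \<in> M" for f
    using F0(3) that unfolding span F(4) by blast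
  show ?case
  proof (cases "\<exists>f\<in>M. hfun f 0 \<noteq> 0")
    case True
    then obtain f where f: "f \<in> M" "hfun f 0 \<noteq> 0" by blast
    note kernel = normalized_kernel0[OF M.closed_subspace_axioms f]
    interpret almost_invariant M ?f0 e m "{0..m}"
    proof unfold_locales
      show "hfun g 0 = cinner g ?f0 * hfun ?f0 0" if "g \<in> M" for g
        using that by (rule kernel(3))
    qed (use kernel(1,2) on orth shift in \<open>simp_all del: One_nat_def\<close>)
    show ?thesis
    \<comment> \<open>The space \<open>K\<close> consists of the coefficient tuples of the elements
      of \<open>M\<close>.\<close>
    proof (intro exI[of _ F] exI[of _ e] conjI disjI1 exI[of _ "tuple ` M"] allI ballI impI)
      show "bshift ?f0 \<in> M + F"
        using shift[OF kernel(1)] unfolding span .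
    qed (use F e True closed_bshift_invariant_tuple hfun_image_eq norm_of_representation in blast)+
  next
    case False
    then have zero: "hfun f 0 = 0" if "f \<in> M" for f using that by blast
    interpret almost_invariant M 0 e m "{1..m}"
      by unfold_locales
        (simp_all add: assms hardy.subspace_0 zero on orth shift del: One_nat_def)
    show ?thesis
    proof (intro exI[of _ F] exI[of _ e] conjI disjI2 exI[of _ "tuple ` M"] allI ballI impI)
      show "hfun ` M = {f. \<exists>k\<in>tuple ` M. \<forall>z. f z = z * (\<Sum>j=1..m. hfun (k j) z * hfun (e j) z)}"
        using hfun_image_eq by simp
      show "(norm f)\<^sup>2 = (\<Sum>j=1..m. (norm (k j))\<^sup>2)"
        if "k \<in> tuple ` M" "\<forall>z. hfun f z = z * (\<Sum>j=1..m. hfun (k j) z * hfun (e j) z)" for f k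
        using that norm_of_representation[of k f] by simp
    qed (use F e zero closed_bshift_invariant_tuple in blast)+
  qed
next
  case 2
  have mem: "e j \<in> F" if "orthonormal_basis e m F" "j \<in> {1..m}" for e F j
    using that unfolding orthonormal_basis_def by (auto intro: hardy.span_base)
  from 2 show ?case
  proof (elim exE conjE disjE, goal_cases)
    case (1 F e K)
    show ?case
    proof (rule almost_invariant_bshift_if_representation[where e = e and ?f0.0 = "normalized_kernel0 M",
          OF assms 1(1-3) mem[OF 1(4)]])
      show "(\<lambda>j. bshift (k j)) \<in> K" if "k \<in> K" for k
        using 1 that by (auto simp: closed_bshift_invariant_def)
    qed (insert 1, assumption)+
  next
    case (2 F e K)
    show ?case
    proof (rule almost_invariant_bshift_if_representation[where e = e and ?f0.0 = 0, OF assms 2(1-3) mem[OF 2(4)]])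
      show "(\<lambda>j. bshift (k j)) \<in> K" if "k \<in> K" for k
        using 2 that by (auto simp: closed_bshift_invariant_def)
      \<comment> \<open>The term with \<open>k 0\<close> has the factor \<open>hfun 0 z\<close>,
        which is 0, so the formula agrees with the assumed one.\<close>
      show "hfun ` M = {f. \<exists>k\<in>K. \<forall>z. f z = hfun (k 0) z * hfun 0 z
          + z * (\<Sum>j=1..m. hfun (k j) z * hfun (e j) z)}"
        using 2 by simp
      show "bshift 0 \<in> M + F"
        using set_plus_intro[of 0 M 0 F] 2(1) assms by (simp add: hardy.subspace_0)
    qed
  qed
qed

end
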